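(* Let $d\ge 2$ and $n\ge 1$ be integers. The G-concurrence of assistance $G_a$ is an entanglement monotone for mixed states of the tripartite system $\mathbb{C}^d\otimes\mathbb{C}^d\otimes\mathbb{C}^n$ (parties $A,B,S$); that is: (i) For every density operator $\rho_{ABS}$ on $\mathbb{C}^d\otimes\mathbb{C}^d\otimes\mathbb{C}^n$ and every local quantum operation $\{\varepsilon_k\}_k$ performed by a single one of the three parties $A$, $B$ or $S$, $$G_a(\rho_{ABS})\ \ge\ \sum_k p_k\, G_a(\rho_k),\qquad p_k=\mathrm{Tr}\,\varepsilon_k(\rho_{ABS}),\quad \rho_k=\varepsilon_k(\rho_{ABS})/p_k ,$$ where terms with $p_k=0$ are omitted. (ii) $G_a(\rho_{ABS})$ is a convex function of $\rho_{ABS}$.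
   Context: G-concurrence of pure states: for a (possibly sub-normalized) vector $|\phi\rangle=\sum_{i,j=1}^d a_{ij}|i\rangle|j\rangle\in\mathbb{C}^d\otimes\mathbb{C}^d$ with coefficient matrix $A=(a_{ij})$, $G(|\phi\rangle)=d\,[\mathrm{Det}(A^\dagger A)]^{1/d}=d\,|\mathrm{Det}A|^{2/d}$. (For a normalized vector this is $d$ times the geometric mean of the Schmidt numbers, i.e. of the eigenvalues of $A^\dagger A$.) G-concurrence of assistance (GCoA). For a normalized pure state $|\psi\rangle_{ABS}\in\mathbb{C}^d\otimes\mathbb{C}^d\otimes\mathbb{C}^n$, put $\rho_{AB}=\mathrm{Tr}_S|\psi\rangle\langle\psi|$ and define $$G_a(|\psi\rangle_{ABS})=\max\sum_i p_i\,G(|\phi_i\rangle_{AB}),$$ the maximum being over all finite decompositions $\rho_{AB}=\sum_i p_i|\phi_i\rangle\langle\phi_i|$ into normalized pure states with probabilities $p_i$. For a mixed state $\rho_{ABS}$ define $$G_a(\rho_{ABS})=\min\sum_j q_j\,G_a(|\psi_j\rangle_{ABS}),$$ the minimum being over all finite decompositions $\rho_{ABS}=\sum_j q_j|\psi_j\rangle\langle\psi_j|$ into normalized pure states with probabilities $q_j$. Local operation: a finite family of maps $\varepsilon_k(\rho)=\sum_j \hat M_{k,j}\,\rho\,\hat M_{k,j}^\dagger$ whose Kraus operators $\hat M_{k,j}$ act on the space of one party only (mapping $\mathbb{C}^d$ to $\mathbb{C}^d$ for $A$ or $B$, $\mathbb{C}^n$ to $\mathbb{C}^n$ for $S$, tensored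 with the identity on the other parties) and satisfy $\sum_{k,j}\hat M_{k,j}^\dagger\hat M_{k,j}\le I$. *)

theory Defs
  imports "HOL-Analysis.Analysis"
begin

type_synonym 'a op = "((complex, 'a) vec, 'a) vec"

definition dagger :: "complex ^ 'a ^ 'b \<Rightarrow> complex ^ 'b ^ 'a" where
  "dagger M = (\<chi> i j. cnj (M $ j $ i))"

definition cinner :: "complex ^ 'a \<Rightarrow> complex ^ 'a \<Rightarrow> complex" where
  "cinner u v = (\<Sum>i\<in>UNIV. cnj (u $ i) * v $ i)"

definition psd :: "('a::finite) op \<Rightarrow> bool" where
  "psd M \<longleftrightarrow> dagger M = M \<and> (\<forall>v. 0 \<le> Re (cinner v (M *v v)))"

definition loewner_le :: "('a::finite) op \<Rightarrow> 'a op \<Rightarrow> bool" where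
  "loewner_le M N \<longleftrightarrow> psd (N - M)"

definition density_op :: "('a::finite) op \<Rightarrow> bool" where
  "density_op \<rho> \<longleftrightarrow> psd \<rho> \<and> trace \<rho> = 1"

definition ketbra :: "complex ^ 'a \<Rightarrow> 'a op" where
  "ketbra \<phi> = (\<chi> i j. \<phi> $ i * cnj (\<phi> $ j))"

definition pure_decomposition ::
    "('a::finite) op \<Rightarrow> nat \<Rightarrow> (nat \<Rightarrow> real) \<Rightarrow> (nat \<Rightarrow> complex ^ 'a) \<Rightarrow> bool" where
  "pure_decomposition \<rho> m p \<phi> \<longleftrightarrow>
     (\<forall>i<m. 0 \<le> p i \<and> norm (\<phi> i) = 1) \<and> (\<Sum>i<m. p i) = 1 \<and>
     \<rho> = (\<Sum>i<m. p i *\<^sub>R ketbra (\<phi> i))"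

definition coeff_matrix :: "complex ^ ('d \<times> 'd) \<Rightarrow> complex ^ 'd ^ 'd" where
  "coeff_matrix \<phi> = (\<chi> i j. \<phi> $ (i, j))"

text \<open>The determinant below is a nonnegative real number; \<^term>\<open>Re\<close> only changes its type.\<close>

definition G_concurrence :: "complex ^ ('d::finite \<times> 'd) \<Rightarrow> real" where
  "G_concurrence \<phi> =
     real CARD('d) *
       Re (det (dagger (coeff_matrix \<phi>) ** coeff_matrix \<phi>)) powr (1 / real CARD('d))"

lemma det_dagger: "det (dagger (M :: complex ^ 'a ^ 'a)) = cnj (det M)"
proof -
  have "det (dagger M) = det (transpose (dagger M))"
    by simp
  also have "transpose (dagger M) = (\<chi> i j. cnj (M $ i $ j))"
    by (simp add: transpose_def dagger_def)
  also have "det (\<chi> i j. cnj (M $ i $ j)) = cnj (det M)"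
    by (simp add: det_def)
  finally show ?thesis .
qed

lemma G_concurrence_eq_abs_det:
  fixes \<phi> :: "complex ^ ('d::finite \<times> 'd)"
  shows "G_concurrence \<phi> =
    real CARD('d) * cmod (det (coeff_matrix \<phi>)) powr (2 / real CARD('d))"
proof -
  let ?z = "det (coeff_matrix \<phi>)"
  have "det (dagger (coeff_matrix \<phi>) ** coeff_matrix \<phi>) = complex_of_real ((cmod ?z)\<^sup>2)"
    unfolding complex_norm_square by (simp add: det_mul det_dagger mult.commute)
  then have "Re (det (dagger (coeff_matrix \<phi>) ** coeff_matrix \<phi>)) = (cmod ?z)\<^sup>2"
    by (metis Re_complex_of_real)
  moreover have "(cmod ?z)\<^sup>2 powr (1 / real CARD('d)) = cmod ?z powr (2 / real CARD('d))"
    by (cases "?z = 0") (simp_all add: powr_powr flip: powr_numeral)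
  ultimately show ?thesis
    by (simp add: G_concurrence_def)
qed

text \<open>The system \<open>ABS\<close> has the product basis indexed by \<^typ>\<open>'d \<times> 'd \<times> 's\<close>,
  in the order \<open>A\<close>, \<open>B\<close>, \<open>S\<close>.\<close>

definition trace_S :: "('d::finite \<times> 'd \<times> 's::finite) op \<Rightarrow> ('d \<times> 'd) op" where
  "trace_S \<rho> = (\<chi> x y. \<Sum>s\<in>UNIV. \<rho> $ (fst x, snd x, s) $ (fst y, snd y, s))"

text \<open>The values in question are bounded (those of \<^const>\<open>G_concurrence\<close> on unit vectors lie in
  \<open>[0, 1]\<close>), density operators have finite decompositions, and by compactness the supremum and the
  infimum below are attained.\<close>

definition GCoA_pure :: "complex ^ ('d::finite \<times> 'd \<times> 's::finite) \<Rightarrow> real" where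
  "GCoA_pure \<psi> =
     Sup {\<Sum>i<m. p i * G_concurrence (\<phi> i) | m p \<phi>.
            pure_decomposition (trace_S (ketbra \<psi>)) m p \<phi>}"

definition GCoA :: "('d::finite \<times> 'd \<times> 's::finite) op \<Rightarrow> real" where
  "GCoA \<rho> =
     Inf {\<Sum>j<m. q j * GCoA_pure (\<psi> j) | m q \<psi>. pure_decomposition \<rho> m q \<psi>}"

definition tensor_op :: "('a::finite) op \<Rightarrow> ('b::finite) op \<Rightarrow> ('a \<times> 'b) op"
    (infixr \<open>\<otimes>\<^sub>o\<close> 75) where
  "M \<otimes>\<^sub>o N = (\<chi> x y. M $ fst x $ fst y * N $ snd x $ snd y)"

definition local_A :: "('d::finite \<times> 'd \<times> 's::finite) op set" where
  "local_A = {M \<otimes>\<^sub>o mat 1 \<otimes>\<^sub>o mat 1 | M. True}"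

definition local_B :: "('d::finite \<times> 'd \<times> 's::finite) op set" where
  "local_B = {mat 1 \<otimes>\<^sub>o M \<otimes>\<^sub>o mat 1 | M. True}"

definition local_S :: "('d::finite \<times> 'd \<times> 's::finite) op set" where
  "local_S = {mat 1 \<otimes>\<^sub>o mat 1 \<otimes>\<^sub>o M | M. True}"

definition kraus_map :: "nat \<Rightarrow> (nat \<Rightarrow> ('a::finite) op) \<Rightarrow> 'a op \<Rightarrow> 'a op" where
  "kraus_map m M \<rho> = (\<Sum>j<m. M j ** \<rho> ** dagger (M j))"

definition local_operation ::
    "nat \<Rightarrow> (nat \<Rightarrow> ('d::finite \<times> 'd \<times> 's::finite) op \<Rightarrow> ('d \<times> 'd \<times> 's) op) \<Rightarrow> bool" where
  "local_operation K \<epsilon> \<longleftrightarrow>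
     (\<exists>L \<in> {local_A, local_B, local_S}. \<exists>J M.
        (\<forall>k<K. \<forall>j<J k. M k j \<in> L) \<and>
        loewner_le (\<Sum>k<K. \<Sum>j<J k. dagger (M k j) ** M k j) (mat 1) \<and>
        (\<forall>k<K. \<epsilon> k = kraus_map (J k) (M k)))"

text \<open>The trace of a positive semidefinite operator is real, so \<^term>\<open>Re\<close> only changes its type.\<close>

definition outcome_prob :: "(('a::finite) op \<Rightarrow> 'a op) \<Rightarrow> 'a op \<Rightarrow> real" where
  "outcome_prob E \<rho> = Re (trace (E \<rho>))"

definition outcome_state :: "(('a::finite) op \<Rightarrow> 'a op) \<Rightarrow> 'a op \<Rightarrow> 'a op" where
  "outcome_state E \<rho> = E \<rho> /\<^sub>R outcome_prob E \<rho>"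

end

theory Submission
  imports Defs
begin

text \<open>
  Rescaling vectors by the square roots of their probabilities turns decompositions into ensembles
  \<open>\<rho> = \<Sum>\<^sub>i |v\<^sub>i\<rangle>\<langle>v\<^sub>i|\<close> of unnormalised vectors, and the weighted averages of the concurrence into
  plain sums, since \<open>G\<close> is quadratically homogeneous.

  It then suffices to show \<open>\<Sum>\<^sub>k G\<^sub>a(M\<^sub>k \<psi>) \<le> G\<^sub>a(\<psi>)\<close> for a pure state \<open>\<psi>\<close> and local Kraus
  operators \<open>M\<^sub>k\<close>, because these map ensembles of \<open>\<rho>\<close> to ensembles of the outcomes.
  If the \<open>M\<^sub>k\<close> act on \<open>A\<close> or \<open>B\<close>, then \<open>G\<^sub>a(M\<^sub>k \<psi>) \<le> |det M\<^sub>k|\<^bsup>2/d\<^esup> G\<^sub>a(\<psi>)\<close>, and by Hadamard's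
  inequality and AM-GM \<open>\<Sum>\<^sub>k |det M\<^sub>k|\<^bsup>2/d\<^esup> \<le> \<Sum>\<^sub>k tr(M\<^sub>k\<^sup>\<dagger> M\<^sub>k) / d \<le> 1\<close>.
  If they act on \<open>S\<close>, the reduced states of the outcomes sum to at most the reduced state of \<open>\<psi>\<close>,
  and the concurrence of assistance is superadditive.
  Convexity holds because ensembles of \<open>\<rho>\<close> and \<open>\<sigma>\<close> concatenate to an ensemble of \<open>\<rho> + \<sigma>\<close>.
\<close>

section \<open>The determinant and the Frobenius norm\<close>

lemma norm_sq_vec: "(norm (v :: complex ^ 'n::finite))\<^sup>2 = (\<Sum>i\<in>UNIV. (cmod (v $ i))\<^sup>2)"
  by (simp add: norm_vec_def L2_set_def sum_nonneg)

lemma cinner_self: "cinner v v = of_real ((norm (v :: complex ^ 'n::finite))\<^sup>2)"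
  unfolding norm_sq_vec cinner_def
  by (simp add: complex_norm_square mult.commute flip: of_real_power)

lemma Re_cinner: "Re (cinner u v) = u \<bullet> (v :: complex ^ 'n::finite)"
  by (simp add: cinner_def inner_vec_def inner_complex_def)

lemma cinner_commute: "cinner u v = cnj (cinner v u)"
  by (simp add: cinner_def mult.commute)

lemma cinner_add_right: "cinner u (v + w) = cinner u v + cinner u w"
  by (simp add: cinner_def distrib_left sum.distrib)

lemma cinner_diff_right: "cinner u (v - w) = cinner u v - cinner u w"
  by (simp add: cinner_def right_diff_distrib sum_subtractf)

lemma cinner_smult_right: "cinner u (c *s v) = c * cinner u v"
  by (simp add: cinner_def sum_distrib_left ac_simps)

lemma cinner_diff_left: "cinner (u - v) w = cinner u w - cinner v w"
  by (simp add: cinner_def left_diff_distrib sum_subtractf)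

lemma cinner_smult_left: "cinner (c *s u) v = cnj c * cinner u v"
  by (simp add: cinner_def sum_distrib_left ac_simps)

text \<open>Pythagoras: the part removed is the orthogonal projection of \<open>u\<close> onto the
  line of \<open>v\<close>, so \<open>u\<close> becomes strictly shorter unless it was orthogonal to
  \<open>v\<close>.\<close>

lemma norm_sq_project_out:
  fixes u v :: "complex ^ 'n::finite"
  assumes "v \<noteq> 0"
  shows "(norm (u - (cinner v u / cinner v v) *s v))\<^sup>2 =
    (norm u)\<^sup>2 - (cmod (cinner v u))\<^sup>2 / (norm v)\<^sup>2"
proof -
  let ?w = "u - (cinner v u / cinner v v) *s v"
  have nz: "cinner v v \<noteq> 0"
    using assms by (simp add: cinner_self)
  have "cinner ?w ?w = cinner u u - cinner v u * cinner u v / cinner v v"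
    using nz cinner_commute[of v v]
    by (simp add: cinner_diff_left cinner_diff_right cinner_smult_left cinner_smult_right
        field_simps)
  also have "cinner u v = cnj (cinner v u)"
    by (rule cinner_commute)
  also have "cinner v u * cnj (cinner v u) = of_real ((cmod (cinner v u))\<^sup>2)"
    by (simp add: complex_norm_square flip: of_real_power)
  finally have "complex_of_real ((norm ?w)\<^sup>2) =
      of_real ((norm u)\<^sup>2 - (cmod (cinner v u))\<^sup>2 / (norm v)\<^sup>2)"
    by (simp add: cinner_self)
  then show ?thesis
    using of_real_eq_iff by blast
qed

section \<open>Hadamard's inequality and the Frobenius bound\<close>

lemma continuous_on_det: "continuous_on S (\<lambda>A :: complex ^ 'n::finite ^ 'n. det A)"
  unfolding det_def by (intro continuous_intros)

lemma det_row_scale: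
  fixes A :: "complex ^ 'n::finite ^ 'n"
  shows "det (\<chi> k. if k = i then c *s row k A else row k A) = c * det A"
proof -
  have "(\<chi> k. if k = i then row k A else row k A) = A"
    by (simp add: row_def vec_eq_iff)
  then show ?thesis
    using det_row_mul[of i c "\<lambda>k. row k A" "\<lambda>k. row k A"] by simp
qed

text \<open>A matrix maximising \<open>|det|\<close> among those with rows in the unit ball has orthogonal rows:
  otherwise projecting one row along another keeps the determinant and shortens the row.\<close>

lemma cmod_det_le_1:
  fixes B :: "complex ^ 'n::finite ^ 'n"
  assumes B: "\<And>i. norm (B $ i) \<le> 1"
  shows "cmod (det B) \<le> 1"
proof -
  let ?K = "{A :: complex ^ 'n ^ 'n. \<forall>i. norm (A $ i) \<le> 1}"
  have "closed ?K"
    by (intro closed_Collect_all closed_Collect_le continuous_intros)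
  moreover have "bounded ?K"
    unfolding bounded_iff
  proof (intro exI[of _ "\<Sum>i\<in>(UNIV::'n set). 1"] ballI)
    fix A assume "A \<in> ?K"
    then show "norm A \<le> (\<Sum>i\<in>(UNIV::'n set). 1)"
      unfolding norm_vec_def[of A]
      by (intro order_trans[OF L2_set_le_sum] sum_mono) auto
  qed
  ultimately have "compact ?K"
    by (simp add: compact_eq_bounded_closed)
  moreover have "?K \<noteq> {}" using B by blast
  ultimately obtain A where A: "A \<in> ?K"
    and max: "\<And>A'. A' \<in> ?K \<Longrightarrow> cmod (det A') \<le> cmod (det A)"
    using continuous_attains_sup[of ?K "\<lambda>A. cmod (det A)"]
    by (auto intro: continuous_on_norm continuous_on_det)
  have "cmod (det A) \<le> 1"
  proof (cases "det A = 0")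
    case False
    have row_nz: "M $ i \<noteq> 0" if "det M \<noteq> 0" for M :: "complex ^ 'n ^ 'n" and i
      using that det_zero_row(1)[of i M] by (auto simp: row_def vec_eq_iff)
    have orth: "cinner (A $ j) (A $ i) = 0" if "i \<noteq> j" for i j
    proof (rule ccontr)
      assume c: "cinner (A $ j) (A $ i) \<noteq> 0"
      define b where "b = cinner (A $ j) (A $ i) / cinner (A $ j) (A $ j)"
      define A1 where "A1 = (\<chi> k. if k = i then row i A + (- b) *s row j A else row k A)"
      define r where "r = norm (A1 $ i)"
      \<comment> \<open>Rescaling the shortened row to unit length multiplies \<open>|det|\<close>
        by \<open>1 / r > 1\<close>, which contradicts maximality.\<close>
      define A2 where "A2 = (\<chi> k. if k = i then complex_of_real (1 / r) *s row k A1 else row k A1)"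
      have detA1: "det A1 = det A"
        unfolding A1_def by (rule det_row_operation[OF that])
      have rpos: "r > 0"
        using row_nz[of A1 i] False by (simp add: r_def detA1)
      have A1i: "A1 $ i = A $ i - b *s A $ j"
        by (simp add: A1_def row_def vec_eq_iff)
      have "r\<^sup>2 < (norm (A $ i))\<^sup>2"
        unfolding r_def A1i b_def norm_sq_project_out[OF row_nz[OF False]]
        using c row_nz[OF False, of j] by simp
      also have "\<dots> \<le> 1"
        using A by (simp add: power_le_one)
      finally have r1: "r < 1"
        using rpos by (simp add: power_less_one_iff abs_square_less_1)
      have A2k: "A2 $ k = (if k = i then complex_of_real (1 / r) *s (A1 $ i) else A $ k)" for k
        by (simp add: A2_def A1_def row_def vec_eq_iff diff_divide_distrib)
      have "norm (complex_of_real (1 / r) *s (A1 $ i)) = 1"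
      proof -
        have "complex_of_real (1 / r) *s (A1 $ i) = (1 / r) *\<^sub>R (A1 $ i)"
          by (simp add: vec_eq_iff) (simp add: scaleR_conv_of_real)
        then show ?thesis
          using rpos by (simp add: r_def)
      qed
      then have "A2 \<in> ?K"
        using A by (auto simp: A2k)
      then have "cmod (det A2) \<le> cmod (det A)"
        by (rule max)
      moreover have "cmod (det A2) = cmod (det A) / r"
        using rpos unfolding A2_def det_row_scale by (simp add: detA1 norm_mult norm_divide)
      ultimately show False
        using rpos r1 False by (simp add: field_simps)
    qed
    have entry: "(A ** dagger A) $ i $ j = cinner (A $ j) (A $ i)" for i j
      by (simp add: matrix_matrix_mult_def dagger_def cinner_def mult.commute)
    \<comment> \<open>Orthogonal rows make \<open>A ** dagger A\<close> diagonal, with the squared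
      row norms on the diagonal.\<close>
    have "complex_of_real ((cmod (det A))\<^sup>2) = det (A ** dagger A)"
      by (simp add: det_mul det_dagger complex_norm_square flip: of_real_power)
    also have "\<dots> = (\<Prod>i\<in>UNIV. (A ** dagger A) $ i $ i)"
      by (rule det_diagonal) (use orth entry in auto)
    also have "\<dots> = of_real (\<Prod>i\<in>UNIV. (norm (A $ i))\<^sup>2)"
      by (simp add: entry cinner_self)
    finally have "(cmod (det A))\<^sup>2 = (\<Prod>i\<in>UNIV. (norm (A $ i))\<^sup>2)"
      using of_real_eq_iff by blast
    also have "\<dots> \<le> 1"
      using A by (intro prod_le_1) (auto simp: power_le_one)
    finally show ?thesis
      by (simp add: abs_square_le_1)
  qed simp
  then show ?thesis
    using max[of B] B by force
qed

text \<open>By linearity of the determinant in each row the rows can be normalised; a zero row makes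
  both sides vanish.\<close>

lemma Hadamard_inequality:
  fixes A :: "complex ^ 'n::finite ^ 'n"
  shows "cmod (det A) \<le> (\<Prod>i\<in>UNIV. norm (A $ i))"
proof (cases "\<exists>i. A $ i = 0")
  case True
  then obtain i where "row i A = 0"
    by (auto simp: row_def vec_eq_iff)
  then show ?thesis
    by (simp add: det_zero_row prod_nonneg)
next
  case False
  define B where "B = (\<chi> i. (1 / norm (A $ i)) *\<^sub>R A $ i)"
  have "A = (\<chi> i. complex_of_real (norm (A $ i)) *s B $ i)"
    using False by (simp add: B_def vec_eq_iff) (simp add: scaleR_conv_of_real)
  then have "det A = (\<Prod>i\<in>UNIV. complex_of_real (norm (A $ i))) * det (\<chi> i. B $ i)"
    using det_rows_mul[of "\<lambda>i. complex_of_real (norm (A $ i))" "\<lambda>i. B $ i"] by simp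
  then have "cmod (det A) = (\<Prod>i\<in>UNIV. norm (A $ i)) * cmod (det B)"
    by (simp add: norm_mult flip: prod_norm)
  moreover have "cmod (det B) \<le> 1"
    by (rule cmod_det_le_1) (use False in \<open>simp add: B_def\<close>)
  ultimately show ?thesis
    by (simp add: mult_left_le prod_nonneg)
qed

text \<open>AM-GM, from \<open>y \<le> exp (y - 1)\<close> applied to each ratio
  \<open>x i / \<mu>\<close>: the exponents add up to zero, so the product of the ratios is at most
  one.\<close>

lemma prod_le_mean_power:
  fixes x :: "'n::finite \<Rightarrow> real"
  assumes "\<And>i. 0 \<le> x i"
  shows "(\<Prod>i\<in>UNIV. x i) \<le> ((\<Sum>i\<in>UNIV. x i) / CARD('n)) ^ CARD('n)"
proof -
  define \<mu> where "\<mu> = (\<Sum>i\<in>UNIV. x i) / CARD('n)"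
  show ?thesis
  proof (cases "\<mu> = 0")
    case True
    then have "\<forall>i. x i = 0"
      using assms by (simp add: \<mu>_def sum_nonneg_eq_0_iff)
    then show ?thesis
      by simp
  next
    case False
    then have \<mu>: "\<mu> > 0"
      using assms by (simp add: \<mu>_def sum_nonneg less_le)
    have "(\<Prod>i\<in>UNIV. x i / \<mu>) \<le> (\<Prod>i\<in>(UNIV::'n set). exp (x i / \<mu> - 1))"
    proof (intro prod_mono conjI)
      fix i
      show "x i / \<mu> \<le> exp (x i / \<mu> - 1)"
        using exp_ge_add_one_self[of "x i / \<mu> - 1"] by simp
    qed (use assms \<mu> in simp)
    also have "\<dots> = exp (\<Sum>i\<in>(UNIV::'n set). x i / \<mu> - 1)"
      by (simp add: exp_sum)
    also have "(\<Sum>i\<in>(UNIV::'n set). x i / \<mu> - 1) = (\<Sum>i\<in>UNIV. x i) / \<mu> - CARD('n)"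
      by (simp add: sum_subtractf sum_divide_distrib)
    also have "\<dots> = 0"
      using \<mu> by (simp add: \<mu>_def field_simps)
    finally have "(\<Prod>i\<in>UNIV. x i) / \<mu> ^ CARD('n) \<le> 1"
      by (simp add: prod_dividef)
    then show ?thesis
      using \<mu> by (simp add: field_simps flip: \<mu>_def)
  qed
qed

text \<open>Hadamard's inequality, then AM-GM for the squared row norms, then a root. It bounds both
  the concurrence of a vector and the determinant factors of local Kraus operators.\<close>

lemma det_powr_le_Frobenius:
  fixes A :: "complex ^ 'n::finite ^ 'n"
  shows "real CARD('n) * cmod (det A) powr (2 / real CARD('n)) \<le> (\<Sum>i\<in>UNIV. (norm (A $ i))\<^sup>2)"
proof -
  let ?n = "CARD('n)" and ?\<mu> = "(\<Sum>i\<in>UNIV. (norm (A $ i))\<^sup>2) / CARD('n)"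
  have \<mu>: "0 \<le> ?\<mu>"
    by (simp add: sum_nonneg)
  have "(cmod (det A))\<^sup>2 \<le> (\<Prod>i\<in>UNIV. norm (A $ i))\<^sup>2"
    by (intro power_mono Hadamard_inequality) simp
  also have "\<dots> \<le> ?\<mu> ^ ?n"
    using prod_le_mean_power[of "\<lambda>i. (norm (A $ i))\<^sup>2"] by (simp add: prod_power_distrib)
  finally have "((cmod (det A))\<^sup>2) powr (1 / ?n) \<le> (?\<mu> ^ ?n) powr (1 / ?n)"
    by (intro powr_mono2) auto
  also have "\<dots> = ?\<mu>"
  proof (cases "?\<mu> = 0")
    case False
    then have "?\<mu> ^ ?n = ?\<mu> powr ?n"
      using \<mu> by (intro powr_realpow[symmetric]) linarith
    then show ?thesis
      using \<mu> by (simp only: powr_powr) (simp add: sum_nonneg)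
  qed simp
  also have "((cmod (det A))\<^sup>2) powr (1 / ?n) = cmod (det A) powr (2 / ?n)"
    by (cases "det A = 0") (simp_all add: powr_powr flip: powr_numeral)
  finally show ?thesis
    by (simp add: field_simps)
qed

section \<open>Positive semidefinite operators and their ensembles\<close>

lemma dagger_0 [simp]: "dagger 0 = 0"
  by (simp add: dagger_def vec_eq_iff)

lemma dagger_add: "dagger (M + N) = dagger M + dagger N"
  by (simp add: dagger_def vec_eq_iff)

lemma dagger_diff: "dagger (M - N) = dagger M - dagger N"
  by (simp add: dagger_def vec_eq_iff)

lemma dagger_scaleR: "dagger (r *\<^sub>R M) = r *\<^sub>R dagger M"
  by (simp add: dagger_def vec_eq_iff)

lemma dagger_ketbra: "dagger (ketbra v) = ketbra v"
  by (simp add: dagger_def ketbra_def vec_eq_iff)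

lemma cinner_dagger:
  fixes M :: "complex ^ 'a::finite ^ 'b::finite"
  shows "cinner u (dagger M *v w) = cinner (M *v u) w"
proof -
  have "cinner u (dagger M *v w) = (\<Sum>i\<in>UNIV. \<Sum>j\<in>UNIV. cnj (u $ i) * cnj (M $ j $ i) * w $ j)"
    by (simp add: cinner_def matrix_vector_mult_def dagger_def sum_distrib_left mult.assoc)
  also have "\<dots> = (\<Sum>j\<in>UNIV. \<Sum>i\<in>UNIV. cnj (u $ i) * cnj (M $ j $ i) * w $ j)"
    by (rule sum.swap)
  also have "\<dots> = cinner (M *v u) w"
    by (simp add: cinner_def matrix_vector_mult_def sum_distrib_right sum_distrib_left ac_simps)
  finally show ?thesis .
qed

lemma ketbra_mult_vec: "ketbra v *v x = cinner v x *s v"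
  by (simp add: ketbra_def matrix_vector_mult_def cinner_def vec_eq_iff sum_distrib_left
      sum_distrib_right ac_simps)

lemma cinner_ketbra:
  fixes v :: "complex ^ 'a::finite"
  shows "cinner x (ketbra v *v x) = of_real ((cmod (cinner v x))\<^sup>2)"
  by (simp add: ketbra_mult_vec cinner_smult_right cinner_commute[of x v] complex_norm_square
      flip: of_real_power)

lemma ketbra_scaleR: "ketbra (r *\<^sub>R v) = r\<^sup>2 *\<^sub>R ketbra v"
  by (simp add: ketbra_def vec_eq_iff power2_eq_square)

lemma ketbra_matrix_mult: "M ** ketbra v ** dagger M = ketbra (M *v v)"
  by (simp add: ketbra_def matrix_matrix_mult_def matrix_vector_mult_def dagger_def vec_eq_iff
      sum_distrib_left sum_distrib_right ac_simps)

lemma trace_ketbra: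
  fixes v :: "complex ^ 'a::finite"
  shows "trace (ketbra v) = of_real ((norm v)\<^sup>2)"
  unfolding norm_sq_vec
  by (simp add: trace_def ketbra_def complex_norm_square flip: of_real_power)

lemma trace_scaleR: "trace (r *\<^sub>R M) = r *\<^sub>R trace (M :: ('a::finite) op)"
  by (simp add: trace_def scaleR_right.sum)

lemma matrix_scaleR_vec: "(r *\<^sub>R M) *v x = r *\<^sub>R ((M :: ('a::finite) op) *v x)"
  by (simp add: matrix_vector_mult_def vec_eq_iff scaleR_right.sum)

lemma cinner_scaleR_right: "cinner x (r *\<^sub>R v) = r *\<^sub>R cinner x v"
  by (simp add: cinner_def scaleR_right.sum)

section \<open>Cauchy-Schwarz for positive semidefinite forms\<close>

lemma psd_Hermitian_form:
  assumes "psd M"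
  shows "cinner u (M *v v) = cnj (cinner v (M *v u))"
proof -
  have "cinner u (M *v v) = cinner (M *v u) v"
    using cinner_dagger[of u M v] assms by (simp add: psd_def)
  then show ?thesis
    by (metis cinner_commute)
qed

text \<open>Positivity of the form at \<open>v - (s * b) *s x\<close> for real \<open>s\<close>
  gives a quadratic inequality in \<open>s\<close>. The form may be degenerate at \<open>x\<close>,
  which is a separate case.\<close>

lemma psd_Cauchy_Schwarz:
  assumes M: "psd M"
  shows "(cmod (cinner x (M *v v)))\<^sup>2 \<le> Re (cinner x (M *v x)) * Re (cinner v (M *v v))"
proof -
  define b where "b = cinner x (M *v v)"
  define a where "a = Re (cinner x (M *v x))"
  define c where "c = Re (cinner v (M *v v))"
  have a0: "0 \<le> a"
    using M by (simp add: a_def psd_def)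
  have bb: "b * cnj b = of_real ((cmod b)\<^sup>2)"
    by (rule complex_norm_square[symmetric])
  have quadratic: "0 \<le> c - 2 * s * (cmod b)\<^sup>2 + s\<^sup>2 * (cmod b)\<^sup>2 * a" for s
  proof -
    \<comment> \<open>The factor \<open>b\<close> aligns the phases, so that both cross terms equal
      the real number \<open>s * (cmod b)\<^sup>2\<close>.\<close>
    define t where "t = of_real s * b"
    have "0 \<le> Re (cinner (v - t *s x) (M *v (v - t *s x)))"
      using M by (simp add: psd_def)
    also have "cinner (v - t *s x) (M *v (v - t *s x)) =
        cinner v (M *v v) - t * cnj b - cnj t * b + cnj t * t * cinner x (M *v x)"
      using psd_Hermitian_form[OF M, of v x]
      by (simp add: b_def vector_scalar_commute cinner_diff_left cinner_diff_right cinner_smult_left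
          cinner_smult_right algebra_simps)
    also have "t * cnj b = of_real (s * (cmod b)\<^sup>2)"
      by (simp add: t_def mult.assoc bb)
    also have "cnj t * b = of_real (s * (cmod b)\<^sup>2)"
      by (simp add: t_def mult.assoc bb mult.commute[of "cnj b"])
    also have "cnj t * t = of_real (s\<^sup>2 * (cmod b)\<^sup>2)"
    proof -
      have "cnj t * t = of_real (s * s) * (b * cnj b)"
        by (simp add: t_def)
      then show ?thesis
        by (simp add: bb power2_eq_square[of s])
    qed
    finally show ?thesis
      by (simp add: a_def c_def)
  qed
  have "(cmod b)\<^sup>2 \<le> a * c"
  proof (cases "a = 0")
    case True
    have "b = 0"
    proof (rule ccontr)
      assume "b \<noteq> 0"
      then show False
        \<comment> \<open>With \<open>a = 0\<close> the bound is affine in \<open>s\<close>, and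
          this \<open>s\<close> gives it the value \<open>-1\<close>.\<close>
        using quadratic[of "(c + 1) / (2 * (cmod b)\<^sup>2)"] True by simp
    qed
    then show ?thesis
      using True by simp
  next
    case False
    then show ?thesis
      \<comment> \<open>At the vertex \<open>s = 1 / a\<close> the quadratic becomes
        \<open>c - (cmod b)\<^sup>2 / a\<close>.\<close>
      using quadratic[of "1 / a"] a0 by (simp add: field_simps power2_eq_square)
  qed
  then show ?thesis
    by (simp add: a_def b_def c_def)
qed

lemma matrix_axis: "(M *v axis i 1) $ k = M $ k $ i"
  by (simp add: matrix_vector_mult_def axis_def if_distrib cong: if_cong)

lemma cinner_axis: "cinner (axis i 1) v = v $ i"
  by (simp add: cinner_def axis_def if_distrib[of cnj] if_distrib[of "\<lambda>x. x * _"] cong: if_cong)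

lemma psd_add: "psd M \<Longrightarrow> psd N \<Longrightarrow> psd (M + N)"
  by (simp add: psd_def dagger_add matrix_vector_mult_add_rdistrib cinner_add_right)

lemma psd_ketbra: "psd (ketbra v)"
  by (simp add: psd_def dagger_ketbra cinner_ketbra del: of_real_power)

lemma psd_0: "psd 0"
  by (simp add: psd_def cinner_def)

lemma psd_diag:
  assumes "psd M"
  shows "M $ i $ i = of_real (Re (M $ i $ i))" "0 \<le> Re (M $ i $ i)"
proof -
  have "cnj (M $ i $ i) = M $ i $ i"
    using assms by (metis (no_types, lifting) dagger_def psd_def vec_lambda_beta)
  then show "M $ i $ i = of_real (Re (M $ i $ i))"
    by (metis Reals_cnj_iff of_real_Re)
  have "0 \<le> Re (cinner (axis i 1) (M *v axis i 1))"
    using assms by (simp add: psd_def)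
  then show "0 \<le> Re (M $ i $ i)"
    by (simp add: cinner_axis matrix_axis)
qed

text \<open>Cauchy-Schwarz on basis vectors bounds the squared modulus of \<open>M $ k $ i\<close>
  by the product of two diagonal entries.\<close>

lemma psd_entry_0:
  assumes "psd M" "M $ k $ k = 0"
  shows "M $ k $ i = 0"
  using psd_Cauchy_Schwarz[OF assms(1), of "axis k 1" "axis i 1"] assms(2)
  by (simp add: cinner_axis matrix_axis)

text \<open>The lengths of the vectors carry the square roots of the probabilities, and zero vectors
  are harmless. With lists, concatenation corresponds to adding operators.\<close>

definition ensembles :: "('a::finite) op \<Rightarrow> (complex ^ 'a) list set" where
  "ensembles \<rho> = {vs. (\<Sum>v\<leftarrow>vs. ketbra v) = \<rho>}"

lemma ensembles_append: "vs \<in> ensembles \<rho> \<Longrightarrow> ws \<in> ensembles \<sigma> \<Longrightarrow> vs @ ws \<in> ensembles (\<rho> + \<sigma>)"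
  by (auto simp: ensembles_def)

lemma ensembles_scaleR: "vs \<in> ensembles \<rho> \<Longrightarrow> map ((*\<^sub>R) r) vs \<in> ensembles (r\<^sup>2 *\<^sub>R \<rho>)"
proof -
  have "(\<Sum>v\<leftarrow>map ((*\<^sub>R) r) vs. ketbra v) = r\<^sup>2 *\<^sub>R (\<Sum>v\<leftarrow>vs. ketbra v)"
    by (induction vs) (simp_all add: ketbra_scaleR scaleR_add_right)
  then show "vs \<in> ensembles \<rho> \<Longrightarrow> ?thesis"
    by (simp add: ensembles_def)
qed

lemma matrix_add_rdistrib:
  fixes A B :: "'a::semiring_1 ^ 'n::finite ^ 'm"
  shows "(A + B) ** C = A ** C + B ** C"
  by (simp add: matrix_matrix_mult_def vec_eq_iff distrib_right sum.distrib)

lemma ensembles_matrix_mult: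
  assumes "vs \<in> ensembles \<rho>"
  shows "map ((*v) M) vs \<in> ensembles (M ** \<rho> ** dagger M)"
proof -
  have "(\<Sum>v\<leftarrow>map ((*v) M) vs. ketbra v) = M ** (\<Sum>v\<leftarrow>vs. ketbra v) ** dagger M"
    by (induction vs)
      (simp_all add: ketbra_matrix_mult[symmetric] matrix_add_ldistrib matrix_add_rdistrib)
  then show ?thesis
    using assms by (simp add: ensembles_def)
qed

lemma ensembles_trace:
  assumes "vs \<in> ensembles \<rho>"
  shows "trace \<rho> = of_real (\<Sum>v\<leftarrow>vs. (norm v)\<^sup>2)"
proof -
  have "trace (\<Sum>v\<leftarrow>vs. ketbra v) = of_real (\<Sum>v\<leftarrow>vs. (norm v)\<^sup>2)"
    by (induction vs) (simp_all add: trace_add trace_ketbra trace_def[of 0])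
  then show ?thesis
    using assms by (simp add: ensembles_def)
qed

lemma ensembles_form:
  assumes "vs \<in> ensembles \<rho>"
  shows "cinner x (\<rho> *v x) = of_real (\<Sum>v\<leftarrow>vs. (cmod (cinner v x))\<^sup>2)"
proof -
  have "cinner x ((\<Sum>v\<leftarrow>vs. ketbra v) *v x) = of_real (\<Sum>v\<leftarrow>vs. (cmod (cinner v x))\<^sup>2)"
    by (induction vs)
      (simp_all add: matrix_vector_mult_add_rdistrib cinner_add_right cinner_ketbra cinner_def[of _ 0])
  then show ?thesis
    using assms by (simp add: ensembles_def)
qed

text \<open>Symmetric Gaussian elimination: subtracting \<open>|u\<rangle>\<langle>u|\<close>, where \<open>u\<close> is the \<open>i\<close>-th
  column divided by the square root of a nonzero diagonal entry, clears the \<open>i\<close>-th row and column.\<close>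

lemma psd_imp_ensemble: "psd M \<Longrightarrow> ensembles M \<noteq> {}"
proof (induction "card {i. M $ i $ i \<noteq> 0}" arbitrary: M rule: less_induct)
  case less
  show ?case
  proof (cases "\<forall>i. M $ i $ i = 0")
    case True
    then have "M = 0"
      using psd_entry_0[OF less.prems] by (simp add: vec_eq_iff)
    then have "[] \<in> ensembles M"
      by (simp add: ensembles_def)
    then show ?thesis
      by blast
  next
    case False
    then obtain i where i: "M $ i $ i \<noteq> 0"
      by blast
    define m where "m = Re (M $ i $ i)"
    have Mii: "M $ i $ i = of_real m"
      using psd_diag[OF less.prems] by (simp add: m_def)
    have m: "m > 0"
    proof -
      have "m \<noteq> 0"
        using i Mii by auto
      moreover have "0 \<le> m"
        using psd_diag(2)[OF less.prems] by (simp add: m_def)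
      ultimately show ?thesis
        by simp
    qed
    define u where "u = (1 / sqrt m) *\<^sub>R (M *v axis i 1)"
    define N where "N = M - ketbra u"
    have ketbra_u: "ketbra u = (1 / m) *\<^sub>R ketbra (M *v axis i 1)"
      using m by (simp add: u_def ketbra_scaleR power_one_over)
    \<comment> \<open>Positivity after the subtraction is Cauchy-Schwarz between
      \<open>axis i 1\<close> and \<open>v\<close>.\<close>
    have "psd N"
      unfolding psd_def
    proof (intro conjI allI)
      show "dagger N = N"
        using less.prems by (simp add: N_def dagger_diff dagger_ketbra psd_def)
      fix v
      have "cinner (M *v axis i 1) v = cinner (axis i 1) (M *v v)"
        using cinner_dagger[of "axis i 1" M v] less.prems by (simp add: psd_def)
      then have "Re (cinner v (N *v v)) =
          Re (cinner v (M *v v)) - (cmod (cinner (axis i 1) (M *v v)))\<^sup>2 / m"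
        by (simp add: N_def ketbra_u matrix_vector_mult_diff_rdistrib cinner_diff_right
            matrix_scaleR_vec cinner_scaleR_right cinner_ketbra del: of_real_power)
      moreover have "(cmod (cinner (axis i 1) (M *v v)))\<^sup>2 \<le> m * Re (cinner v (M *v v))"
        using psd_Cauchy_Schwarz[OF less.prems, of "axis i 1" v]
        by (simp add: cinner_axis matrix_axis m_def)
      then have "(cmod (cinner (axis i 1) (M *v v)))\<^sup>2 / m \<le> Re (cinner v (M *v v))"
        using m by (simp add: pos_divide_le_eq mult.commute)
      ultimately show "0 \<le> Re (cinner v (N *v v))"
        by simp
    qed
    \<comment> \<open>Zero diagonal entries stay zero because their rows vanish, and entry
      \<open>i\<close> becomes zero, so the induction measure drops.\<close>
    moreover have "{k. N $ k $ k \<noteq> 0} \<subset> {k. M $ k $ k \<noteq> 0}"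
    proof (intro psubsetI)
      have N: "N $ k $ k = M $ k $ k - M $ k $ i * cnj (M $ k $ i) / of_real m" for k
        by (simp add: N_def ketbra_u) (simp add: ketbra_def matrix_axis scaleR_conv_of_real)
      show "{k. N $ k $ k \<noteq> 0} \<subseteq> {k. M $ k $ k \<noteq> 0}"
        using psd_entry_0[OF less.prems] by (auto simp: N)
      have "N $ i $ i = 0"
        using m by (simp add: N Mii)
      then show "{k. N $ k $ k \<noteq> 0} \<noteq> {k. M $ k $ k \<noteq> 0}"
        using i by blast
    qed
    ultimately obtain vs where "vs \<in> ensembles N"
      using less.hyps[of N] by (meson all_not_in_conv finite psubset_card_mono)
    then have "u # vs \<in> ensembles M"
      by (simp add: ensembles_def N_def)
    then show ?thesis
      by blast
  qed
qed

lemma ensemble_imp_psd: "vs \<in> ensembles M \<Longrightarrow> psd M"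
proof -
  have "psd (\<Sum>v\<leftarrow>vs. ketbra v)"
    by (induction vs) (simp_all add: psd_0 psd_add psd_ketbra)
  then show "vs \<in> ensembles M \<Longrightarrow> ?thesis"
    by (simp add: ensembles_def)
qed

lemma psd_sum: "(\<And>i. i \<in> I \<Longrightarrow> psd (f i)) \<Longrightarrow> psd (sum f I)"
  by (induction I rule: infinite_finite_induct) (simp_all add: psd_0 psd_add)

lemma psd_scaleR: "psd M \<Longrightarrow> psd (r\<^sup>2 *\<^sub>R M)"
  by (simp add: psd_def dagger_scaleR matrix_scaleR_vec cinner_scaleR_right)

lemma dagger_mult: "dagger (A ** B) = dagger B ** dagger (A :: ('a::finite) op)"
  by (simp add: dagger_def matrix_matrix_mult_def vec_eq_iff mult.commute)

lemma dagger_mat_1: "dagger (mat 1) = (mat 1 :: ('a::finite) op)"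
  by (simp add: dagger_def mat_def vec_eq_iff)

lemma dagger_sum: "dagger (\<Sum>i\<in>I. f i) = (\<Sum>i\<in>I. dagger (f i))"
  by (induction I rule: infinite_finite_induct) (simp_all add: dagger_add)

lemma sum_matrix_mult:
  "M ** (\<Sum>i\<in>I. f i) ** N = (\<Sum>i\<in>I. M ** f i ** (N :: ('a::finite) op))"
  by (induction I rule: infinite_finite_induct)
    (simp_all add: matrix_add_ldistrib matrix_add_rdistrib)

lemma matrix_vector_mult_sum_left: "(\<Sum>i\<in>I. f i) *v x = (\<Sum>i\<in>I. (f i :: ('a::finite) op) *v x)"
  by (induction I rule: infinite_finite_induct) (simp_all add: matrix_vector_mult_add_rdistrib)

lemma cinner_sum_right: "cinner x (\<Sum>i\<in>I. f i) = (\<Sum>i\<in>I. cinner x (f i))"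
  by (induction I rule: infinite_finite_induct) (simp_all add: cinner_add_right cinner_def[of _ 0])

lemma psd_conjugate:
  assumes "psd \<sigma>"
  shows "psd (M ** \<sigma> ** dagger M)"
proof -
  obtain vs where "vs \<in> ensembles \<sigma>"
    using psd_imp_ensemble[OF assms] by blast
  then show ?thesis
    using ensemble_imp_psd ensembles_matrix_mult by blast
qed

text \<open>The operator annihilates the orthogonal complement of the range of \<open>M\<close>. Its
  form at a vector there is the sum of squared overlaps with the ensemble, so every overlap is
  zero.\<close>

lemma ensemble_in_range:
  assumes vs: "vs \<in> ensembles (M ** \<sigma> ** dagger M)" and v: "v \<in> set vs"
  shows "\<exists>u. v = M *v u"
proof -
  have "subspace (range ((*v) M))"
    by (intro linear_subspace_image subspace_UNIV) simp
  then obtain y z where y: "y \<in> range ((*v) M)"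
    and z: "\<And>w. w \<in> range ((*v) M) \<Longrightarrow> orthogonal z w" and vyz: "v = y + z"
    using orthogonal_subspace_decomp_exists[of "range ((*v) M)" v]
    by (metis span_eq_iff)
  \<comment> \<open>The squared norm of \<open>q\<close> is the real inner product of
    \<open>M *v q\<close> with \<open>z\<close>, which is zero because \<open>M *v q\<close> lies in
    the range.\<close>
  define q where "q = dagger M *v z"
  have "(norm q)\<^sup>2 = Re (cinner q (dagger M *v z))"
    by (simp add: cinner_self flip: q_def)
  also have "\<dots> = (M *v q) \<bullet> z"
    by (simp add: cinner_dagger Re_cinner)
  also have "\<dots> = 0"
    using z[of "M *v q"] by (simp add: orthogonal_def inner_commute)
  finally have "dagger M *v z = 0"
    by (simp add: q_def)
  then have "(M ** \<sigma> ** dagger M) *v z = 0"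
    by (simp flip: matrix_vector_mul_assoc)
  then have "complex_of_real (\<Sum>v\<leftarrow>vs. (cmod (cinner v z))\<^sup>2) = 0"
    using ensembles_form[OF vs, of z] by (simp add: cinner_def[of z 0])
  then have "(\<Sum>v\<leftarrow>vs. (cmod (cinner v z))\<^sup>2) = 0"
    by (simp only: of_real_eq_0_iff)
  then have "cinner v z = 0"
    using v by (subst (asm) sum_list_nonneg_eq_0_iff) auto
  then have "v \<bullet> z = 0"
    by (metis Re_cinner zero_complex.simps(1))
  then have "z = 0"
    using z[OF y] by (simp add: vyz orthogonal_def inner_add_left inner_commute[of y z])
  then show ?thesis
    using y vyz by auto
qed

text \<open>A weight and its unit vector correspond to the vector scaled by the square root of the
  weight; homogeneity of \<open>f\<close> matches the values, and the trace condition makes the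
  weights sum to one. It serves both the supremum and the infimum.\<close>

lemma pure_decomposition_values:
  fixes f :: "complex ^ 'a::finite \<Rightarrow> real"
  assumes tr: "trace \<rho> = 1"
    and f: "\<And>r v. f (r *\<^sub>R v) = r\<^sup>2 * f v"
  shows "{\<Sum>i<m. p i * f (\<phi> i) | m p \<phi>. pure_decomposition \<rho> m p \<phi>} =
    (\<lambda>vs. \<Sum>v\<leftarrow>vs. f v) ` ensembles \<rho>"
proof (intro equalityI subsetI)
  fix t assume "t \<in> {\<Sum>i<m. p i * f (\<phi> i) | m p \<phi>. pure_decomposition \<rho> m p \<phi>}"
  then obtain m p \<phi> where t: "t = (\<Sum>i<m. p i * f (\<phi> i))"
    and dec: "pure_decomposition \<rho> m p \<phi>"
    by blast
  define vs where "vs = map (\<lambda>i. sqrt (p i) *\<^sub>R \<phi> i) [0..<m]"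
  have sq: "(sqrt (p i))\<^sup>2 = p i" if "i < m" for i
    using dec that by (simp add: pure_decomposition_def)
  have "(\<Sum>v\<leftarrow>vs. ketbra v) = \<rho>"
    using dec sq
    by (simp add: vs_def o_def interv_sum_list_conv_sum_set_nat atLeast0LessThan ketbra_scaleR
        pure_decomposition_def del: real_sqrt_pow2_iff)
  moreover have "(\<Sum>v\<leftarrow>vs. f v) = t"
    using sq by (simp add: vs_def o_def interv_sum_list_conv_sum_set_nat atLeast0LessThan f t
        del: real_sqrt_pow2_iff)
  ultimately show "t \<in> (\<lambda>vs. \<Sum>v\<leftarrow>vs. f v) ` ensembles \<rho>"
    by (auto simp: ensembles_def)
next
  fix t assume "t \<in> (\<lambda>vs. \<Sum>v\<leftarrow>vs. f v) ` ensembles \<rho>"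
  then obtain vs where vs: "vs \<in> ensembles \<rho>" and t: "t = (\<Sum>v\<leftarrow>vs. f v)"
    by blast
  \<comment> \<open>A zero vector receives an arbitrary unit vector, since its weight is
    zero.\<close>
  define \<phi> where "\<phi> i = (if vs ! i = 0 then axis undefined 1 else (1 / norm (vs ! i)) *\<^sub>R vs ! i)" for i
  define p where "p i = (norm (vs ! i))\<^sup>2" for i
  have nth: "vs ! i = norm (vs ! i) *\<^sub>R \<phi> i" and unit: "norm (\<phi> i) = 1" for i
    by (simp_all add: \<phi>_def)
  have sum_nth: "(\<Sum>v\<leftarrow>vs. g v) = (\<Sum>i<length vs. g (vs ! i))" for g :: "_ \<Rightarrow> 'b::comm_monoid_add"
    by (simp add: sum_list_sum_nth atLeast0LessThan)
  have ketbra_nth: "ketbra (vs ! i) = p i *\<^sub>R ketbra (\<phi> i)" for i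
    unfolding p_def ketbra_scaleR[symmetric] using nth[of i] by simp
  have f_nth: "f (vs ! i) = p i * f (\<phi> i)" for i
    unfolding p_def f[symmetric] using nth[of i] by simp
  have "pure_decomposition \<rho> (length vs) p \<phi>"
    unfolding pure_decomposition_def
  proof (intro conjI allI impI)
    have "complex_of_real (\<Sum>i<length vs. p i) = 1"
      using ensembles_trace[OF vs] tr by (simp only: sum_nth p_def)
    then show "(\<Sum>i<length vs. p i) = 1"
      using of_real_eq_1_iff by blast
    show "\<rho> = (\<Sum>i<length vs. p i *\<^sub>R ketbra (\<phi> i))"
      using vs by (simp add: ensembles_def sum_nth ketbra_nth)
  qed (simp_all add: p_def unit)
  then show "t \<in> {\<Sum>i<m. p i * f (\<phi> i) | m p \<phi>. pure_decomposition \<rho> m p \<phi>}"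
    by (auto simp: t sum_nth f_nth)
qed

section \<open>Tensor products\<close>

lemma sum_UNIV_pair:
  "(\<Sum>z\<in>(UNIV :: ('a::finite \<times> 'b::finite) set). f z) = (\<Sum>a\<in>UNIV. \<Sum>b\<in>UNIV. f (a, b))"
  by (simp add: sum.cartesian_product flip: UNIV_Times_UNIV)

definition tensor_vec :: "complex ^ 'a \<Rightarrow> complex ^ 'b \<Rightarrow> complex ^ ('a \<times> 'b)" where
  "tensor_vec u w = (\<chi> z. u $ fst z * w $ snd z)"

lemma tensor_op_tensor_vec:
  "(M \<otimes>\<^sub>o N) *v tensor_vec u w = tensor_vec (M *v u) (N *v w)"
  by (simp add: tensor_op_def tensor_vec_def matrix_vector_mult_def vec_eq_iff sum_UNIV_pair
      sum_product ac_simps)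

lemma norm_tensor_vec: "norm (tensor_vec u w) = norm u * norm (w :: complex ^ 'b::finite)"
proof -
  have "(norm (tensor_vec u w))\<^sup>2 = (norm u * norm w)\<^sup>2"
    by (simp add: norm_sq_vec tensor_vec_def sum_UNIV_pair sum_product norm_mult power_mult_distrib)
  then show ?thesis
    by (simp add: power2_eq_iff_nonneg)
qed

lemma tensor_op_mult: "(M \<otimes>\<^sub>o N) ** (P \<otimes>\<^sub>o Q) = (M ** P) \<otimes>\<^sub>o (N ** Q)"
  by (simp add: tensor_op_def matrix_matrix_mult_def vec_eq_iff sum_UNIV_pair sum_product ac_simps)

lemma tensor_op_mat_1: "mat 1 \<otimes>\<^sub>o mat 1 = mat 1"
  by (simp add: tensor_op_def mat_def vec_eq_iff prod_eq_iff)

text \<open>The bound on the sum of \<open>dagger (M k) ** M k\<close> by the identity, as a norm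
  inequality that can be tested on product vectors.\<close>

definition contractive :: "'i set \<Rightarrow> ('i \<Rightarrow> ('a::finite) op) \<Rightarrow> bool" where
  "contractive I M \<longleftrightarrow> (\<forall>v. (\<Sum>k\<in>I. (norm (M k *v v))\<^sup>2) \<le> (norm v)\<^sup>2)"

lemma norm_axis_1: "norm (axis i (1 :: complex)) = 1"
  by (simp add: norm_eq_sqrt_inner inner_axis_axis)

text \<open>Product vectors with a unit second factor strip off the identity.\<close>

lemma contractive_tensor_left:
  assumes "contractive I (\<lambda>k. M k \<otimes>\<^sub>o (mat 1 :: ('b::finite) op))"
  shows "contractive I M"
  unfolding contractive_def
proof
  fix u
  show "(\<Sum>k\<in>I. (norm (M k *v u))\<^sup>2) \<le> (norm u)\<^sup>2"
    using assms[unfolded contractive_def, rule_format, of "tensor_vec u (axis undefined 1)"]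
    by (simp add: tensor_op_tensor_vec norm_tensor_vec norm_axis_1)
qed

lemma contractive_tensor_right:
  assumes "contractive I (\<lambda>k. (mat 1 :: ('b::finite) op) \<otimes>\<^sub>o M k)"
  shows "contractive I M"
  unfolding contractive_def
proof
  fix u
  show "(\<Sum>k\<in>I. (norm (M k *v u))\<^sup>2) \<le> (norm u)\<^sup>2"
    using assms[unfolded contractive_def, rule_format, of "tensor_vec (axis undefined 1) u"]
    by (simp add: tensor_op_tensor_vec norm_tensor_vec norm_axis_1)
qed

text \<open>The Frobenius bounds add up to the total squared length of the images of the basis
  vectors, and each basis vector contributes at most one.\<close>

lemma contractive_sum_det:
  fixes M :: "'i \<Rightarrow> ('d::finite) op"
  assumes "contractive I M"
  shows "(\<Sum>k\<in>I. cmod (det (M k)) powr (2 / real CARD('d))) \<le> 1"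
proof -
  have "real CARD('d) * (\<Sum>k\<in>I. cmod (det (M k)) powr (2 / real CARD('d)))
      \<le> (\<Sum>k\<in>I. \<Sum>i\<in>UNIV. (norm (M k $ i))\<^sup>2)"
    unfolding sum_distrib_left by (intro sum_mono det_powr_le_Frobenius)
  also have "\<dots> = (\<Sum>k\<in>I. \<Sum>j\<in>UNIV. (norm (M k *v axis j 1))\<^sup>2)"
    unfolding norm_sq_vec matrix_axis by (intro sum.cong refl sum.swap)
  also have "\<dots> = (\<Sum>j\<in>UNIV. \<Sum>k\<in>I. (norm (M k *v axis j 1))\<^sup>2)"
    by (rule sum.swap)
  also have "\<dots> \<le> (\<Sum>j\<in>(UNIV :: 'd set). (norm (axis j (1 :: complex)))\<^sup>2)"
    using assms unfolding contractive_def by (intro sum_mono) blast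
  also have "\<dots> = real CARD('d)"
    by (simp add: norm_axis_1)
  finally show ?thesis
    by simp
qed

section \<open>The concurrence of assistance of an unnormalised operator\<close>

lemma G_concurrence_nonneg: "0 \<le> G_concurrence \<phi>"
  by (simp add: G_concurrence_def)

text \<open>This keeps the supremum over ensembles finite. The Frobenius norm of the coefficient
  matrix is the norm of \<open>\<phi>\<close>.\<close>

lemma G_concurrence_le_norm_sq: "G_concurrence \<phi> \<le> (norm \<phi>)\<^sup>2"
proof -
  have "G_concurrence \<phi> \<le> (\<Sum>i\<in>UNIV. (norm (coeff_matrix \<phi> $ i))\<^sup>2)"
    unfolding G_concurrence_eq_abs_det by (rule det_powr_le_Frobenius)
  also have "\<dots> = (norm \<phi>)\<^sup>2"
    by (simp add: norm_sq_vec coeff_matrix_def sum_UNIV_pair)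
  finally show ?thesis .
qed

text \<open>On the coefficient matrix, \<open>M\<close> acts by left multiplication and
  \<open>N\<close> by right multiplication with its transpose.\<close>

lemma G_concurrence_tensor_op:
  fixes M N :: "('d::finite) op"
  shows "G_concurrence ((M \<otimes>\<^sub>o N) *v v) =
    (cmod (det M) * cmod (det N)) powr (2 / real CARD('d)) * G_concurrence v"
proof -
  have "coeff_matrix ((M \<otimes>\<^sub>o N) *v v) = M ** (coeff_matrix v ** transpose N)"
    by (simp add: tensor_op_def coeff_matrix_def matrix_vector_mult_def matrix_matrix_mult_def
        transpose_def vec_eq_iff sum_UNIV_pair sum_distrib_left ac_simps)
  then have "cmod (det (coeff_matrix ((M \<otimes>\<^sub>o N) *v v))) =
      (cmod (det M) * cmod (det N)) * cmod (det (coeff_matrix v))"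
    by (simp add: det_mul norm_mult)
  then show ?thesis
    unfolding G_concurrence_eq_abs_det by (simp add: powr_mult)
qed

lemma G_concurrence_scaleR: "G_concurrence (r *\<^sub>R v) = r\<^sup>2 * G_concurrence (v :: complex ^ ('d::finite \<times> 'd))"
proof -
  have "coeff_matrix (r *\<^sub>R v) = (\<chi> i. complex_of_real r *s coeff_matrix v $ i)"
    by (simp add: coeff_matrix_def vec_eq_iff) (simp add: scaleR_conv_of_real)
  then have "det (coeff_matrix (r *\<^sub>R v)) = of_real r ^ CARD('d) * det (coeff_matrix v)"
    using det_rows_mul[of "\<lambda>_. complex_of_real r" "\<lambda>i. coeff_matrix v $ i"] by simp
  then have "cmod (det (coeff_matrix (r *\<^sub>R v))) = \<bar>r\<bar> ^ CARD('d) * cmod (det (coeff_matrix v))"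
    by (simp add: norm_mult norm_power)
  moreover have "(\<bar>r\<bar> ^ CARD('d)) powr (2 / real CARD('d)) = r\<^sup>2"
  proof (cases "r = 0")
    case False
    then have "\<bar>r\<bar> ^ CARD('d) = \<bar>r\<bar> powr real CARD('d)" "r\<^sup>2 = \<bar>r\<bar> powr 2"
      by (simp_all add: powr_realpow)
    then show ?thesis
      by (simp add: powr_powr)
  qed simp
  ultimately show ?thesis
    by (simp add: G_concurrence_eq_abs_det powr_mult)
qed

text \<open>Concurrence of assistance for unnormalised operators; \<open>GCoA_pure_eq\<close> links
  it to \<open>GCoA_pure\<close> on unit vectors.\<close>

definition G_assist :: "('d::finite \<times> 'd) op \<Rightarrow> real" where
  "G_assist \<sigma> = (SUP vs\<in>ensembles \<sigma>. \<Sum>v\<leftarrow>vs. G_concurrence v)"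

lemma ensemble_G_le_trace:
  assumes "vs \<in> ensembles \<sigma>"
  shows "(\<Sum>v\<leftarrow>vs. G_concurrence v) \<le> Re (trace \<sigma>)"
proof -
  have "(\<Sum>v\<leftarrow>vs. G_concurrence v) \<le> (\<Sum>v\<leftarrow>vs. (norm v)\<^sup>2)"
    by (intro sum_list_mono G_concurrence_le_norm_sq)
  then show ?thesis
    by (simp add: ensembles_trace[OF assms])
qed

lemma G_assist_upper:
  assumes "vs \<in> ensembles \<sigma>"
  shows "(\<Sum>v\<leftarrow>vs. G_concurrence v) \<le> G_assist \<sigma>"
  unfolding G_assist_def
  by (rule cSUP_upper[OF assms]) (meson bdd_aboveI2 ensemble_G_le_trace)

lemma G_assist_least:
  assumes "psd \<sigma>" "\<And>vs. vs \<in> ensembles \<sigma> \<Longrightarrow> (\<Sum>v\<leftarrow>vs. G_concurrence v) \<le> b"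
  shows "G_assist \<sigma> \<le> b"
  unfolding G_assist_def by (rule cSUP_least) (use assms psd_imp_ensemble in auto)

lemma G_assist_nonneg:
  assumes "psd \<sigma>"
  shows "0 \<le> G_assist \<sigma>"
proof -
  obtain vs where "vs \<in> ensembles \<sigma>"
    using psd_imp_ensemble[OF assms] by blast
  then have "(\<Sum>v\<leftarrow>vs. G_concurrence v) \<le> G_assist \<sigma>"
    by (rule G_assist_upper)
  moreover have "0 \<le> (\<Sum>v\<leftarrow>vs. G_concurrence v)"
    by (intro sum_list_nonneg) (auto simp: G_concurrence_nonneg)
  ultimately show ?thesis
    by linarith
qed

text \<open>Concatenated ensembles compete in the supremum for the sum; the two suprema are taken
  one after the other.\<close>

lemma G_assist_superadditive:
  assumes "psd \<sigma>" "psd \<tau>"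
  shows "G_assist \<sigma> + G_assist \<tau> \<le> G_assist (\<sigma> + \<tau>)"
proof -
  have "G_assist \<tau> \<le> G_assist (\<sigma> + \<tau>) - G_assist \<sigma>"
  proof (rule G_assist_least[OF assms(2)])
    fix ws assume ws: "ws \<in> ensembles \<tau>"
    have "G_assist \<sigma> \<le> G_assist (\<sigma> + \<tau>) - (\<Sum>v\<leftarrow>ws. G_concurrence v)"
    proof (rule G_assist_least[OF assms(1)])
      fix vs assume "vs \<in> ensembles \<sigma>"
      then show "(\<Sum>v\<leftarrow>vs. G_concurrence v) \<le> G_assist (\<sigma> + \<tau>) - (\<Sum>v\<leftarrow>ws. G_concurrence v)"
        using G_assist_upper[OF ensembles_append[OF _ ws]] by force
    qed
    then show "(\<Sum>v\<leftarrow>ws. G_concurrence v) \<le> G_assist (\<sigma> + \<tau>) - G_assist \<sigma>"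
      by simp
  qed
  then show ?thesis
    by simp
qed

lemma G_assist_sum:
  assumes "\<And>k. k \<in> I \<Longrightarrow> psd (\<sigma> k)"
  shows "(\<Sum>k\<in>I. G_assist (\<sigma> k)) \<le> G_assist (\<Sum>k\<in>I. \<sigma> k)"
  using assms
proof (induction I rule: infinite_finite_induct)
  case (insert k I)
  then have "G_assist (\<sigma> k) + G_assist (\<Sum>k\<in>I. \<sigma> k) \<le> G_assist (\<sigma> k + (\<Sum>k\<in>I. \<sigma> k))"
    by (intro G_assist_superadditive psd_sum) auto
  then show ?case
    using insert by simp
qed (simp_all add: G_assist_nonneg psd_0)

text \<open>Rescaling ensembles gives one inequality for every nonzero factor; the reverse one is
  its instance at \<open>1 / r\<close>.\<close>

lemma G_assist_scaleR:
  fixes \<sigma> :: "('d::finite \<times> 'd) op"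
  assumes "psd \<sigma>"
  shows "G_assist (r\<^sup>2 *\<^sub>R \<sigma>) = r\<^sup>2 * G_assist \<sigma>"
proof -
  have le: "G_assist (s\<^sup>2 *\<^sub>R \<tau>) \<le> s\<^sup>2 * G_assist \<tau>" if "psd \<tau>" "s \<noteq> 0" for s and \<tau> :: "('d \<times> 'd) op"
  proof (rule G_assist_least[OF psd_scaleR[OF that(1)]])
    fix vs assume "vs \<in> ensembles (s\<^sup>2 *\<^sub>R \<tau>)"
    then have "map ((*\<^sub>R) (1 / s)) vs \<in> ensembles ((1 / s)\<^sup>2 *\<^sub>R s\<^sup>2 *\<^sub>R \<tau>)"
      by (rule ensembles_scaleR)
    also have "(1 / s)\<^sup>2 *\<^sub>R s\<^sup>2 *\<^sub>R \<tau> = \<tau>"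
      using that by (simp add: power_one_over)
    finally have "(\<Sum>v\<leftarrow>vs. G_concurrence ((1 / s) *\<^sub>R v)) \<le> G_assist \<tau>"
      using G_assist_upper by (fastforce simp: o_def)
    then have "(1 / s)\<^sup>2 * (\<Sum>v\<leftarrow>vs. G_concurrence v) \<le> G_assist \<tau>"
      by (simp only: G_concurrence_scaleR sum_list_const_mult)
    then show "(\<Sum>v\<leftarrow>vs. G_concurrence v) \<le> s\<^sup>2 * G_assist \<tau>"
      using that by (simp add: power_one_over field_simps)
  qed
  show ?thesis
  proof (cases "r = 0")
    case True
    have "G_assist (0 :: ('d \<times> 'd) op) \<le> 0"
      using ensemble_G_le_trace by (intro G_assist_least[OF psd_0]) (fastforce simp: trace_def)
    moreover have "0 \<le> G_assist (0 :: ('d \<times> 'd) op)"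
      by (rule G_assist_nonneg[OF psd_0])
    ultimately show ?thesis
      using True by simp
  next
    case False
    have "G_assist ((1 / r)\<^sup>2 *\<^sub>R r\<^sup>2 *\<^sub>R \<sigma>) \<le> (1 / r)\<^sup>2 * G_assist (r\<^sup>2 *\<^sub>R \<sigma>)"
      using False assms by (intro le psd_scaleR) auto
    moreover have "(1 / r)\<^sup>2 *\<^sub>R r\<^sup>2 *\<^sub>R \<sigma> = \<sigma>"
      using False by (simp add: power_one_over)
    ultimately have "r\<^sup>2 * G_assist \<sigma> \<le> G_assist (r\<^sup>2 *\<^sub>R \<sigma>)"
      using False by (simp add: power_one_over field_simps)
    then show ?thesis
      using le[OF assms False] by simp
  qed
qed

text \<open>If \<open>M \<otimes> N\<close> is singular, every ensemble of \<open>(M \<otimes> N) \<sigma> (M \<otimes> N)\<^sup>\<dagger>\<close> lies in its range, where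
  \<^const>\<open>G_concurrence\<close> vanishes.\<close>

lemma G_assist_tensor_op:
  fixes M N :: "('d::finite) op"
  assumes \<sigma>: "psd \<sigma>"
  shows "G_assist ((M \<otimes>\<^sub>o N) ** \<sigma> ** dagger (M \<otimes>\<^sub>o N)) \<le>
    (cmod (det M) * cmod (det N)) powr (2 / real CARD('d)) * G_assist \<sigma>"
proof (rule G_assist_least[OF psd_conjugate[OF \<sigma>]])
  let ?T = "M \<otimes>\<^sub>o N" and ?\<gamma> = "(cmod (det M) * cmod (det N)) powr (2 / real CARD('d))"
  fix vs assume vs: "vs \<in> ensembles (?T ** \<sigma> ** dagger ?T)"
  show "(\<Sum>v\<leftarrow>vs. G_concurrence v) \<le> ?\<gamma> * G_assist \<sigma>"
  proof (cases "det M = 0 \<or> det N = 0")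
    case True
    then have "G_concurrence v = 0" if "v \<in> set vs" for v
      using ensemble_in_range[OF vs that] by (auto simp: G_concurrence_tensor_op)
    then have "(\<Sum>v\<leftarrow>vs. G_concurrence v) = 0"
      by (simp cong: map_cong)
    then show ?thesis
      using True by auto
  next
    case False
    then obtain M' N' where inv: "M' ** M = mat 1" "M ** M' = mat 1" "N' ** N = mat 1" "N ** N' = mat 1"
      by (meson invertible_def invertible_det_nz)
    let ?S = "M' \<otimes>\<^sub>o N'"
    have ST: "?S ** ?T = mat 1" and TS: "?T ** ?S = mat 1"
      by (simp_all add: tensor_op_mult inv tensor_op_mat_1)
    \<comment> \<open>Pulling the ensemble back through the inverse gives an ensemble of
      \<open>\<sigma>\<close>.\<close>
    have "?S ** (?T ** \<sigma> ** dagger ?T) ** dagger ?S = (?S ** ?T) ** \<sigma> ** dagger (?S ** ?T)"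
      by (simp add: dagger_mult matrix_mul_assoc)
    also have "\<dots> = \<sigma>"
      by (simp add: ST dagger_mat_1)
    finally have "map ((*v) ?S) vs \<in> ensembles \<sigma>"
      using ensembles_matrix_mult[OF vs, of ?S] by simp
    then have "(\<Sum>v\<leftarrow>vs. G_concurrence (?S *v v)) \<le> G_assist \<sigma>"
      using G_assist_upper by (fastforce simp: o_def)
    then have "?\<gamma> * (\<Sum>v\<leftarrow>vs. G_concurrence (?S *v v)) \<le> ?\<gamma> * G_assist \<sigma>"
      by (intro mult_left_mono) auto
    \<comment> \<open>The factor \<open>?\<gamma>\<close> is the effect of \<open>?T\<close> on the
      concurrence, and \<open>?T\<close> undoes \<open>?S\<close>.\<close>
    also have "?\<gamma> * (\<Sum>v\<leftarrow>vs. G_concurrence (?S *v v)) =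
        (\<Sum>v\<leftarrow>vs. G_concurrence (?T *v (?S *v v)))"
      by (simp add: G_concurrence_tensor_op sum_list_const_mult)
    also have "\<dots> = (\<Sum>v\<leftarrow>vs. G_concurrence v)"
      by (simp only: matrix_vector_mul_assoc TS matrix_vector_mul_lid)
    finally show ?thesis .
  qed
qed

section \<open>Local operations on pure tripartite states\<close>

text \<open>The unnormalised vector of \<open>AB\<close> conditional on the basis state
  \<open>s\<close> of \<open>S\<close>. The slices form an ensemble of the reduced state.\<close>

definition slice :: "'s \<Rightarrow> complex ^ ('d::finite \<times> 'd \<times> 's::finite) \<Rightarrow> complex ^ ('d \<times> 'd)" where
  "slice s \<psi> = (\<chi> x. \<psi> $ (fst x, snd x, s))"

lemma trace_S_ketbra: "trace_S (ketbra \<psi>) = (\<Sum>s\<in>UNIV. ketbra (slice s \<psi>))"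
  by (simp add: trace_S_def ketbra_def slice_def vec_eq_iff)

lemma psd_trace_S_ketbra: "psd (trace_S (ketbra \<psi>))"
  unfolding trace_S_ketbra by (intro psd_sum psd_ketbra)

lemma trace_trace_S: "trace (trace_S \<rho>) = trace \<rho>"
  by (simp add: trace_def trace_S_def sum_UNIV_pair)

lemma slice_AB: "slice s ((M \<otimes>\<^sub>o N \<otimes>\<^sub>o mat 1) *v \<psi>) = (M \<otimes>\<^sub>o N) *v slice s \<psi>"
  by (simp add: slice_def tensor_op_def matrix_vector_mult_def vec_eq_iff sum_UNIV_pair mat_def
      if_distrib[of "\<lambda>x. _ * x"] if_distrib[of "\<lambda>x. x * _"] mult.assoc cong: if_cong)

lemma slice_S: "slice s ((mat 1 \<otimes>\<^sub>o mat 1 \<otimes>\<^sub>o N) *v \<psi>) = (\<Sum>t\<in>UNIV. N $ s $ t *s slice t \<psi>)"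
proof -
  have "((mat 1 \<otimes>\<^sub>o mat 1 \<otimes>\<^sub>o N) *v \<psi>) $ (a, b, s) = (\<Sum>t\<in>UNIV. N $ s $ t * \<psi> $ (a, b, t))" for a b
  proof -
    have "((mat 1 \<otimes>\<^sub>o mat 1 \<otimes>\<^sub>o N) *v \<psi>) $ (a, b, s) =
        (\<Sum>a'\<in>UNIV. if a = a' then
          (\<Sum>b'\<in>UNIV. if b = b' then (\<Sum>t\<in>UNIV. N $ s $ t * \<psi> $ (a', b', t)) else 0) else 0)"
      unfolding matrix_vector_mult_def tensor_op_def vec_lambda_beta sum_UNIV_pair
      by (auto simp: mat_def simp del: sum.delta sum.delta' intro!: sum.cong)
    then show ?thesis
      by simp
  qed
  then show ?thesis
    by (simp add: slice_def vec_eq_iff)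
qed

lemma trace_S_AB:
  "trace_S (ketbra ((M \<otimes>\<^sub>o N \<otimes>\<^sub>o mat 1) *v \<psi>)) =
    (M \<otimes>\<^sub>o N) ** trace_S (ketbra \<psi>) ** dagger (M \<otimes>\<^sub>o N)"
  by (simp add: trace_S_ketbra slice_AB sum_matrix_mult ketbra_matrix_mult)

text \<open>The overlaps with the slices form a vector on \<open>S\<close>, on which operators of
  \<open>S\<close> act directly.\<close>

lemma trace_S_ketbra_form:
  fixes \<psi> :: "complex ^ ('d::finite \<times> 'd \<times> 's::finite)"
  shows "cinner x (trace_S (ketbra \<psi>) *v x) =
    of_real ((norm (\<chi> s. cinner x (slice s \<psi>)))\<^sup>2)"
proof -
  have "cinner x ((\<Sum>s\<in>I. ketbra (slice s \<psi>)) *v x) =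
      of_real (\<Sum>s\<in>I. (cmod (cinner x (slice s \<psi>)))\<^sup>2)" for I :: "'s set"
  proof (induction I rule: infinite_finite_induct)
    case (insert s I)
    then show ?case
      using cinner_commute[of x "slice s \<psi>"]
      by (simp add: matrix_vector_mult_add_rdistrib cinner_add_right cinner_ketbra)
  qed (simp_all add: cinner_def[of _ 0])
  then show ?thesis
    by (simp add: trace_S_ketbra norm_sq_vec)
qed

abbreviation pure_assist :: "complex ^ ('d::finite \<times> 'd \<times> 's::finite) \<Rightarrow> real" where
  "pure_assist \<psi> \<equiv> G_assist (trace_S (ketbra \<psi>))"

text \<open>Treats \<open>A\<close> and \<open>B\<close> at once: each Kraus operator scales the
  assistance by at most its determinant factor.\<close>

lemma pure_assist_AB:
  fixes M N :: "'i \<Rightarrow> ('d::finite) op" and \<psi> :: "complex ^ ('d \<times> 'd \<times> 's::finite)"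
  assumes "(\<Sum>k\<in>I. (cmod (det (M k)) * cmod (det (N k))) powr (2 / real CARD('d))) \<le> 1"
  shows "(\<Sum>k\<in>I. pure_assist ((M k \<otimes>\<^sub>o N k \<otimes>\<^sub>o mat 1) *v \<psi>)) \<le> pure_assist \<psi>"
proof -
  have "(\<Sum>k\<in>I. pure_assist ((M k \<otimes>\<^sub>o N k \<otimes>\<^sub>o mat 1) *v \<psi>)) \<le>
      (\<Sum>k\<in>I. (cmod (det (M k)) * cmod (det (N k))) powr (2 / real CARD('d)) * pure_assist \<psi>)"
    unfolding trace_S_AB by (intro sum_mono G_assist_tensor_op psd_trace_S_ketbra)
  also have "\<dots> \<le> pure_assist \<psi>"
    unfolding sum_distrib_right[symmetric]
    using assms by (intro mult_left_le_one_le G_assist_nonneg psd_trace_S_ketbra sum_nonneg) auto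
  finally show ?thesis .
qed

text \<open>An operation on \<open>S\<close> refines the available decompositions of the state of \<open>AB\<close>, up to the
  positive semidefinite part lost by a trace-decreasing operation.\<close>

lemma pure_assist_S:
  fixes N :: "'i \<Rightarrow> ('s::finite) op" and \<psi> :: "complex ^ ('d::finite \<times> 'd \<times> 's)"
  assumes "contractive I N"
  shows "(\<Sum>k\<in>I. pure_assist ((mat 1 \<otimes>\<^sub>o mat 1 \<otimes>\<^sub>o N k) *v \<psi>)) \<le> pure_assist \<psi>"
proof -
  define \<sigma> where "\<sigma> k = trace_S (ketbra ((mat 1 \<otimes>\<^sub>o mat 1 \<otimes>\<^sub>o N k) *v \<psi>))" for k
  define \<tau> where "\<tau> = trace_S (ketbra \<psi>) - (\<Sum>k\<in>I. \<sigma> k)"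
  have \<sigma>: "psd (\<sigma> k)" for k
    unfolding \<sigma>_def by (rule psd_trace_S_ketbra)
  have "psd \<tau>"
    unfolding psd_def
  proof (intro conjI allI)
    show "dagger \<tau> = \<tau>"
      using \<sigma> psd_trace_S_ketbra[of \<psi>] by (simp add: \<tau>_def dagger_diff dagger_sum psd_def)
    fix x
    \<comment> \<open>An operator on \<open>S\<close> acts on \<open>y\<close> as
      \<open>N k\<close>, so positivity of \<open>\<tau>\<close> at \<open>x\<close> is
      contractivity of \<open>N\<close> at \<open>y\<close>.\<close>
    define y where "y = (\<chi> s. cinner x (slice s \<psi>))"
    have form: "cinner x (\<sigma> k *v x) = of_real ((norm (N k *v y))\<^sup>2)" for k
    proof -
      have "(\<chi> s. cinner x (slice s ((mat 1 \<otimes>\<^sub>o mat 1 \<otimes>\<^sub>o N k) *v \<psi>))) = N k *v y"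
        unfolding slice_S cinner_sum_right cinner_smult_right
        by (simp add: y_def matrix_vector_mult_def)
      then show ?thesis
        by (simp add: \<sigma>_def trace_S_ketbra_form)
    qed
    have "Re (cinner x (\<tau> *v x)) = (norm y)\<^sup>2 - (\<Sum>k\<in>I. (norm (N k *v y))\<^sup>2)"
      by (simp add: \<tau>_def matrix_vector_mult_diff_rdistrib cinner_diff_right trace_S_ketbra_form
          matrix_vector_mult_sum_left cinner_sum_right form y_def del: of_real_power)
    then show "0 \<le> Re (cinner x (\<tau> *v x))"
      using assms by (simp add: contractive_def)
  qed
  have "(\<Sum>k\<in>I. G_assist (\<sigma> k)) \<le> G_assist (\<Sum>k\<in>I. \<sigma> k)"
    by (intro G_assist_sum \<sigma>)
  also have "\<dots> \<le> G_assist (\<Sum>k\<in>I. \<sigma> k) + G_assist \<tau>"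
    using G_assist_nonneg[OF \<open>psd \<tau>\<close>] by simp
  also have "\<dots> \<le> G_assist ((\<Sum>k\<in>I. \<sigma> k) + \<tau>)"
    by (intro G_assist_superadditive psd_sum \<sigma> \<open>psd \<tau>\<close>)
  also have "(\<Sum>k\<in>I. \<sigma> k) + \<tau> = trace_S (ketbra \<psi>)"
    by (simp add: \<tau>_def)
  finally show ?thesis
    by (simp add: \<sigma>_def)
qed

text \<open>Stripping identities leaves a contractive family on one party. For \<open>A\<close> and
  \<open>B\<close>, \<open>contractive_sum_det\<close> supplies the hypothesis of
  \<open>pure_assist_AB\<close>; for \<open>S\<close>, contractivity is used directly.\<close>

lemma pure_assist_local:
  fixes M :: "'i \<Rightarrow> ('d::finite \<times> 'd \<times> 's::finite) op"
  assumes L: "L \<in> {local_A, local_B, local_S}"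
    and M: "\<And>k. k \<in> I \<Longrightarrow> M k \<in> L"
    and contr: "contractive I M"
  shows "(\<Sum>k\<in>I. pure_assist (M k *v \<psi>)) \<le> pure_assist \<psi>"
proof -
  have contr': "contractive I M'" if "\<And>k. k \<in> I \<Longrightarrow> M k = M' k" for M'
    using contr that by (simp add: contractive_def)
  consider "L = local_A" | "L = local_B" | "L = local_S"
    using L by blast
  then show ?thesis
  proof cases
    case 1
    then obtain N where N: "\<And>k. k \<in> I \<Longrightarrow> M k = N k \<otimes>\<^sub>o mat 1 \<otimes>\<^sub>o mat 1"
      using M unfolding local_A_def by (simp, metis)
    have "contractive I (\<lambda>k. N k \<otimes>\<^sub>o (mat 1 :: 'd op) \<otimes>\<^sub>o (mat 1 :: 's op))"
      by (rule contr') (rule N)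
    then have "contractive I N"
      unfolding tensor_op_mat_1 by (rule contractive_tensor_left)
    then have "(\<Sum>k\<in>I. pure_assist ((N k \<otimes>\<^sub>o mat 1 \<otimes>\<^sub>o mat 1) *v \<psi>)) \<le> pure_assist \<psi>"
      by (intro pure_assist_AB) (simp add: contractive_sum_det)
    then show ?thesis
      by (simp add: N)
  next
    case 2
    then obtain N where N: "\<And>k. k \<in> I \<Longrightarrow> M k = mat 1 \<otimes>\<^sub>o N k \<otimes>\<^sub>o mat 1"
      using M unfolding local_B_def by (simp, metis)
    have "contractive I (\<lambda>k. (mat 1 :: 'd op) \<otimes>\<^sub>o N k \<otimes>\<^sub>o (mat 1 :: 's op))"
      by (rule contr') (rule N)
    then have "contractive I (\<lambda>k. N k \<otimes>\<^sub>o (mat 1 :: 's op))"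
      by (rule contractive_tensor_right)
    then have "contractive I N"
      by (rule contractive_tensor_left)
    then have "(\<Sum>k\<in>I. pure_assist ((mat 1 \<otimes>\<^sub>o N k \<otimes>\<^sub>o mat 1) *v \<psi>)) \<le> pure_assist \<psi>"
      by (intro pure_assist_AB) (simp add: contractive_sum_det)
    then show ?thesis
      by (simp add: N)
  next
    case 3
    then obtain N where N: "\<And>k. k \<in> I \<Longrightarrow> M k = mat 1 \<otimes>\<^sub>o mat 1 \<otimes>\<^sub>o N k"
      using M unfolding local_S_def by (simp, metis)
    have "contractive I (\<lambda>k. (mat 1 :: 'd op) \<otimes>\<^sub>o (mat 1 :: 'd op) \<otimes>\<^sub>o N k)"
      by (rule contr') (rule N)
    then have "contractive I (\<lambda>k. (mat 1 :: 'd op) \<otimes>\<^sub>o N k)"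
      by (rule contractive_tensor_right)
    then have "contractive I N"
      by (rule contractive_tensor_right)
    then have "(\<Sum>k\<in>I. pure_assist ((mat 1 \<otimes>\<^sub>o mat 1 \<otimes>\<^sub>o N k) *v \<psi>)) \<le> pure_assist \<psi>"
      by (rule pure_assist_S)
    then show ?thesis
      by (simp add: N)
  qed
qed

lemma loewner_le_imp_contractive:
  fixes M :: "'i \<Rightarrow> ('a::finite) op"
  assumes "loewner_le (\<Sum>k\<in>I. dagger (M k) ** M k) (mat 1)"
  shows "contractive I M"
  unfolding contractive_def
proof
  fix v
  have "0 \<le> Re (cinner v ((mat 1 - (\<Sum>k\<in>I. dagger (M k) ** M k)) *v v))"
    using assms by (simp add: loewner_le_def psd_def)
  also have "\<dots> = (norm v)\<^sup>2 - (\<Sum>k\<in>I. (norm (M k *v v))\<^sup>2)"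
    by (simp add: matrix_vector_mult_diff_rdistrib cinner_diff_right matrix_vector_mult_sum_left
        cinner_sum_right cinner_dagger cinner_self del: of_real_power
        flip: matrix_vector_mul_assoc)
  finally show "(\<Sum>k\<in>I. (norm (M k *v v))\<^sup>2) \<le> (norm v)\<^sup>2"
    by simp
qed

section \<open>Mixed states\<close>

text \<open>Convex-roof extension of \<open>pure_assist\<close> to unnormalised operators; it agrees
  with \<open>GCoA\<close> on density operators by \<open>GCoA_eq\<close>.\<close>

definition mixed_assist :: "('d::finite \<times> 'd \<times> 's::finite) op \<Rightarrow> real" where
  "mixed_assist \<rho> = (INF \<psi>s\<in>ensembles \<rho>. \<Sum>\<psi>\<leftarrow>\<psi>s. pure_assist \<psi>)"

lemma pure_assist_nonneg: "0 \<le> pure_assist \<psi>"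
  by (intro G_assist_nonneg psd_trace_S_ketbra)

lemma pure_assist_scaleR: "pure_assist (r *\<^sub>R \<psi>) = r\<^sup>2 * pure_assist \<psi>"
proof -
  have "trace_S (ketbra (r *\<^sub>R \<psi>)) = r\<^sup>2 *\<^sub>R trace_S (ketbra \<psi>)"
    by (simp add: ketbra_scaleR trace_S_def vec_eq_iff scaleR_right.sum)
  then show ?thesis
    by (simp add: G_assist_scaleR psd_trace_S_ketbra)
qed

lemma GCoA_pure_eq:
  assumes "norm \<psi> = 1"
  shows "GCoA_pure \<psi> = pure_assist \<psi>"
  unfolding GCoA_pure_def G_assist_def using assms
  by (subst pure_decomposition_values)
    (simp_all add: trace_trace_S trace_ketbra G_concurrence_scaleR)

lemma GCoA_eq:
  assumes "density_op \<rho>"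
  shows "GCoA \<rho> = mixed_assist \<rho>"
proof -
  \<comment> \<open>Decompositions contain only unit vectors, where \<open>GCoA_pure\<close> and
    \<open>pure_assist\<close> agree.\<close>
  have "(\<Sum>j<m. q j * GCoA_pure (\<psi> j)) = (\<Sum>j<m. q j * pure_assist (\<psi> j))"
    if "pure_decomposition \<rho> m q \<psi>" for m q \<psi>
    using that by (intro sum.cong) (auto simp: pure_decomposition_def GCoA_pure_eq)
  then have "{\<Sum>j<m. q j * GCoA_pure (\<psi> j) | m q \<psi>. pure_decomposition \<rho> m q \<psi>} =
      {\<Sum>j<m. q j * pure_assist (\<psi> j) | m q \<psi>. pure_decomposition \<rho> m q \<psi>}"
    by (smt (verit) Collect_cong)
  also have "\<dots> = (\<lambda>\<psi>s. \<Sum>\<psi>\<leftarrow>\<psi>s. pure_assist \<psi>) ` ensembles \<rho>"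
    using assms
    by (intro pure_decomposition_values pure_assist_scaleR) (simp add: density_op_def)
  finally show ?thesis
    by (simp add: GCoA_def mixed_assist_def)
qed

lemma mixed_assist_lower:
  assumes "\<psi>s \<in> ensembles \<rho>"
  shows "mixed_assist \<rho> \<le> (\<Sum>\<psi>\<leftarrow>\<psi>s. pure_assist \<psi>)"
  unfolding mixed_assist_def
proof (rule cINF_lower[OF _ assms])
  show "bdd_below ((\<lambda>\<psi>s. \<Sum>\<psi>\<leftarrow>\<psi>s. pure_assist \<psi>) ` ensembles \<rho>)"
    by (intro bdd_belowI2[of _ 0] sum_list_nonneg) (auto simp: pure_assist_nonneg)
qed

lemma mixed_assist_greatest:
  assumes "psd \<rho>" "\<And>\<psi>s. \<psi>s \<in> ensembles \<rho> \<Longrightarrow> b \<le> (\<Sum>\<psi>\<leftarrow>\<psi>s. pure_assist \<psi>)"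
  shows "b \<le> mixed_assist \<rho>"
  unfolding mixed_assist_def by (rule cINF_greatest) (use assms psd_imp_ensemble in auto)

text \<open>Vectors are rescaled by \<open>1 / sqrt c\<close>. With \<open>c\<close> an outcome
  probability, this absorbs the normalisation of the outcome state.\<close>

lemma mixed_assist_scaleR_le:
  assumes "psd \<rho>" "0 < c"
  shows "c * mixed_assist (\<rho> /\<^sub>R c) \<le> mixed_assist \<rho>"
proof (rule mixed_assist_greatest[OF assms(1)])
  fix \<psi>s assume "\<psi>s \<in> ensembles \<rho>"
  then have "map ((*\<^sub>R) (1 / sqrt c)) \<psi>s \<in> ensembles ((1 / sqrt c)\<^sup>2 *\<^sub>R \<rho>)"
    by (rule ensembles_scaleR)
  also have "(1 / sqrt c)\<^sup>2 *\<^sub>R \<rho> = \<rho> /\<^sub>R c"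
    using assms(2) by (simp add: power_one_over inverse_eq_divide)
  finally have "mixed_assist (\<rho> /\<^sub>R c) \<le> (\<Sum>\<psi>\<leftarrow>\<psi>s. pure_assist ((1 / sqrt c) *\<^sub>R \<psi>))"
    using mixed_assist_lower by (fastforce simp: o_def)
  also have "\<dots> = (1 / c) * (\<Sum>\<psi>\<leftarrow>\<psi>s. pure_assist \<psi>)"
    using assms(2) by (simp only: pure_assist_scaleR sum_list_const_mult) (simp add: power_one_over)
  finally show "c * mixed_assist (\<rho> /\<^sub>R c) \<le> (\<Sum>\<psi>\<leftarrow>\<psi>s. pure_assist \<psi>)"
    using assms(2) by (simp add: field_simps)
qed

text \<open>Dual to \<open>G_assist_superadditive\<close>: concatenated ensembles compete in an
  infimum.\<close>

lemma mixed_assist_subadditive: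
  assumes "psd \<rho>" "psd \<sigma>"
  shows "mixed_assist (\<rho> + \<sigma>) \<le> mixed_assist \<rho> + mixed_assist \<sigma>"
proof -
  have "mixed_assist (\<rho> + \<sigma>) - mixed_assist \<rho> \<le> mixed_assist \<sigma>"
  proof (rule mixed_assist_greatest[OF assms(2)])
    fix \<phi>s assume \<phi>s: "\<phi>s \<in> ensembles \<sigma>"
    have "mixed_assist (\<rho> + \<sigma>) - (\<Sum>\<phi>\<leftarrow>\<phi>s. pure_assist \<phi>) \<le> mixed_assist \<rho>"
    proof (rule mixed_assist_greatest[OF assms(1)])
      fix \<psi>s assume "\<psi>s \<in> ensembles \<rho>"
      then show "mixed_assist (\<rho> + \<sigma>) - (\<Sum>\<phi>\<leftarrow>\<phi>s. pure_assist \<phi>) \<le> (\<Sum>\<psi>\<leftarrow>\<psi>s. pure_assist \<psi>)"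
        using mixed_assist_lower[OF ensembles_append[OF _ \<phi>s]] by force
    qed
    then show "mixed_assist (\<rho> + \<sigma>) - mixed_assist \<rho> \<le> (\<Sum>\<phi>\<leftarrow>\<phi>s. pure_assist \<phi>)"
      by simp
  qed
  then show ?thesis
    by simp
qed

lemma mixed_assist_scaleR:
  assumes "psd \<rho>" "0 < c"
  shows "mixed_assist (c *\<^sub>R \<rho>) = c * mixed_assist \<rho>"
proof (rule antisym)
  have psd_c: "psd (c *\<^sub>R \<rho>)"
    using psd_scaleR[OF assms(1), of "sqrt c"] assms(2) by simp
  show "c * mixed_assist \<rho> \<le> mixed_assist (c *\<^sub>R \<rho>)"
    using mixed_assist_scaleR_le[OF psd_c assms(2)] assms(2) by simp
  have "(1 / c) * mixed_assist (\<rho> /\<^sub>R (1 / c)) \<le> mixed_assist \<rho>"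
    using assms by (intro mixed_assist_scaleR_le) auto
  then show "mixed_assist (c *\<^sub>R \<rho>) \<le> c * mixed_assist \<rho>"
    using assms(2) by (simp add: field_simps)
qed

section \<open>Convexity\<close>

lemma density_op_convex_combination:
  assumes "density_op \<rho>" "density_op \<sigma>" "0 < t" "t < 1"
  shows "density_op ((1 - t) *\<^sub>R \<rho> + t *\<^sub>R \<sigma>)"
proof -
  have "psd ((sqrt (1 - t))\<^sup>2 *\<^sub>R \<rho> + (sqrt t)\<^sup>2 *\<^sub>R \<sigma>)"
    using assms by (intro psd_add psd_scaleR) (auto simp: density_op_def)
  moreover have "trace ((1 - t) *\<^sub>R \<rho> + t *\<^sub>R \<sigma>) = (1 - t) *\<^sub>R 1 + t *\<^sub>R 1"
    using assms by (simp add: density_op_def trace_add trace_scaleR)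
  moreover have "\<dots> = 1"
    by (simp add: scaleR_conv_of_real)
  ultimately show ?thesis
    using assms by (simp add: density_op_def)
qed

text \<open>Subadditivity splits the mixture, and homogeneity takes out the weights.\<close>

lemma convex_on_GCoA:
  "convex_on {\<rho> :: ('d::finite \<times> 'd \<times> 's::finite) op. density_op \<rho>} GCoA"
proof (rule convex_onI)
  fix t :: real and \<rho> \<sigma> :: "('d \<times> 'd \<times> 's) op"
  assume t: "0 < t" "t < 1" and "\<rho> \<in> {\<rho>. density_op \<rho>}" "\<sigma> \<in> {\<rho>. density_op \<rho>}"
  then have \<rho>: "density_op \<rho>" "psd \<rho>" and \<sigma>: "density_op \<sigma>" "psd \<sigma>"
    by (auto simp: density_op_def)
  have "psd ((sqrt (1 - t))\<^sup>2 *\<^sub>R \<rho>)" "psd ((sqrt t)\<^sup>2 *\<^sub>R \<sigma>)"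
    by (intro psd_scaleR \<rho> \<sigma>)+
  then have "mixed_assist ((1 - t) *\<^sub>R \<rho> + t *\<^sub>R \<sigma>) \<le>
      mixed_assist ((1 - t) *\<^sub>R \<rho>) + mixed_assist (t *\<^sub>R \<sigma>)"
    using t by (intro mixed_assist_subadditive) auto
  then show "GCoA ((1 - t) *\<^sub>R \<rho> + t *\<^sub>R \<sigma>) \<le> (1 - t) * GCoA \<rho> + t * GCoA \<sigma>"
    using t \<rho> \<sigma> by (simp add: GCoA_eq density_op_convex_combination mixed_assist_scaleR)
next
  show "convex {\<rho> :: ('d \<times> 'd \<times> 's) op. density_op \<rho>}"
    unfolding convex_alt
  proof (intro ballI allI impI)
    fix \<rho> \<sigma> :: "('d \<times> 'd \<times> 's) op" and t :: real
    assume "\<rho> \<in> {\<rho>. density_op \<rho>}" "\<sigma> \<in> {\<rho>. density_op \<rho>}" "0 \<le> t \<and> t \<le> 1"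
    then show "(1 - t) *\<^sub>R \<rho> + t *\<^sub>R \<sigma> \<in> {\<rho>. density_op \<rho>}"
      \<comment> \<open>The endpoints are treated directly, since the combination lemma assumes
        \<open>t\<close> strictly between 0 and 1.\<close>
      using density_op_convex_combination[of \<rho> \<sigma> t] by (cases "t = 0 \<or> t = 1") auto
  qed
qed

section \<open>Monotonicity under local operations\<close>

lemma kraus_map_ensemble:
  assumes "\<psi>s \<in> ensembles \<rho>"
  shows "concat (map (\<lambda>j. map ((*v) (M j)) \<psi>s) [0..<m]) \<in> ensembles (kraus_map m M \<rho>)"
proof (induction m)
  case 0
  then show ?case
    by (simp add: kraus_map_def ensembles_def)
next
  case (Suc m)
  then show ?case
    using ensembles_append[OF Suc ensembles_matrix_mult[OF assms, of "M m"]]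
    by (simp add: kraus_map_def)
qed

text \<open>The images of \<open>\<psi>s\<close> under the Kraus operators form one competitor in
  the infimum for the unnormalised outcome.\<close>

lemma kraus_map_outcome_le:
  fixes M :: "nat \<Rightarrow> ('d::finite \<times> 'd \<times> 's::finite) op"
  assumes \<psi>s: "\<psi>s \<in> ensembles \<rho>"
    and p: "outcome_prob (kraus_map m M) \<rho> \<noteq> 0"
  shows "outcome_prob (kraus_map m M) \<rho> * GCoA (outcome_state (kraus_map m M) \<rho>) \<le>
    (\<Sum>j<m. \<Sum>\<psi>\<leftarrow>\<psi>s. pure_assist (M j *v \<psi>))"
proof -
  let ?E = "kraus_map m M" and ?p = "outcome_prob (kraus_map m M) \<rho>"
  let ?\<phi>s = "concat (map (\<lambda>j. map ((*v) (M j)) \<psi>s) [0..<m])"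
  have \<phi>s: "?\<phi>s \<in> ensembles (?E \<rho>)"
    by (rule kraus_map_ensemble[OF \<psi>s])
  have psd: "psd (?E \<rho>)"
    by (rule ensemble_imp_psd[OF \<phi>s])
  have tr: "trace (?E \<rho>) = of_real ?p"
    unfolding outcome_prob_def ensembles_trace[OF \<phi>s] by simp
  have "?p = (\<Sum>v\<leftarrow>?\<phi>s. (norm v)\<^sup>2)"
    unfolding outcome_prob_def ensembles_trace[OF \<phi>s] by (rule Re_complex_of_real)
  also have "\<dots> \<ge> 0"
    by (intro sum_list_nonneg) auto
  finally have pos: "?p > 0"
    using p by simp
  have "psd ((1 / sqrt ?p)\<^sup>2 *\<^sub>R ?E \<rho>)"
    by (rule psd_scaleR[OF psd])
  then have "psd (outcome_state ?E \<rho>)"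
    using pos by (simp add: outcome_state_def power_one_over inverse_eq_divide)
  moreover have "trace (outcome_state ?E \<rho>) = inverse ?p *\<^sub>R complex_of_real ?p"
    by (simp add: outcome_state_def trace_scaleR tr)
  moreover have "\<dots> = 1"
    using p by (simp add: scaleR_conv_of_real)
  ultimately have "density_op (outcome_state ?E \<rho>)"
    by (simp add: density_op_def)
  then have "?p * GCoA (outcome_state ?E \<rho>) \<le> mixed_assist (?E \<rho>)"
    using mixed_assist_scaleR_le[OF psd pos] by (simp add: GCoA_eq outcome_state_def)
  also have "\<dots> \<le> (\<Sum>\<phi>\<leftarrow>?\<phi>s. pure_assist \<phi>)"
    by (rule mixed_assist_lower[OF \<phi>s])
  also have "\<dots> = (\<Sum>j<m. \<Sum>\<psi>\<leftarrow>\<psi>s. pure_assist (M j *v \<psi>))"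
    by (induction m) (simp_all add: o_def)
  finally show ?thesis .
qed

text \<open>The pure-state inequality, applied to each vector, gives the bound for every ensemble of
  \<open>\<rho>\<close>; then the infimum is taken.\<close>

lemma GCoA_monotone:
  fixes \<rho> :: "('d::finite \<times> 'd \<times> 's::finite) op"
  assumes \<rho>: "density_op \<rho>" and op: "local_operation K \<epsilon>"
  shows "(\<Sum>k | k < K \<and> outcome_prob (\<epsilon> k) \<rho> \<noteq> 0.
      outcome_prob (\<epsilon> k) \<rho> * GCoA (outcome_state (\<epsilon> k) \<rho>)) \<le> GCoA \<rho>"
proof -
  obtain L J M where L: "L \<in> {local_A, local_B, local_S}"
    and M: "\<And>k j. k < K \<Longrightarrow> j < J k \<Longrightarrow> M k j \<in> L"
    and le: "loewner_le (\<Sum>k<K. \<Sum>j<J k. dagger (M k j) ** M k j) (mat 1)"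
    and \<epsilon>: "\<And>k. k < K \<Longrightarrow> \<epsilon> k = kraus_map (J k) (M k)"
    using op unfolding local_operation_def
    by (elim bexE exE conjE) (rule that, assumption, simp_all)
  \<comment> \<open>The pairs \<open>(k, j)\<close> index the Kraus operators of all outcomes as a
    single contractive family.\<close>
  let ?I = "SIGMA k:{..<K}. {..<J k}"
  have "contractive ?I (\<lambda>(k, j). M k j)"
    using le by (intro loewner_le_imp_contractive) (simp add: sum.Sigma case_prod_unfold)
  then have pure: "(\<Sum>(k, j)\<in>?I. pure_assist (M k j *v \<psi>)) \<le> pure_assist \<psi>" for \<psi>
    using pure_assist_local[OF L, of ?I "\<lambda>(k, j). M k j" \<psi>] M by (auto simp: case_prod_unfold)
  have "(\<Sum>k | k < K \<and> outcome_prob (\<epsilon> k) \<rho> \<noteq> 0.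
      outcome_prob (\<epsilon> k) \<rho> * GCoA (outcome_state (\<epsilon> k) \<rho>)) \<le> (\<Sum>\<psi>\<leftarrow>\<psi>s. pure_assist \<psi>)"
    if \<psi>s: "\<psi>s \<in> ensembles \<rho>" for \<psi>s
  proof -
    have "(\<Sum>k | k < K \<and> outcome_prob (\<epsilon> k) \<rho> \<noteq> 0.
        outcome_prob (\<epsilon> k) \<rho> * GCoA (outcome_state (\<epsilon> k) \<rho>)) \<le>
      (\<Sum>k | k < K \<and> outcome_prob (\<epsilon> k) \<rho> \<noteq> 0. \<Sum>j<J k. \<Sum>\<psi>\<leftarrow>\<psi>s. pure_assist (M k j *v \<psi>))"
      by (intro sum_mono) (auto simp: \<epsilon> kraus_map_outcome_le[OF \<psi>s])
    \<comment> \<open>Outcomes of probability zero are restored; their terms are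
      nonnegative.\<close>
    also have "\<dots> \<le> (\<Sum>k<K. \<Sum>j<J k. \<Sum>\<psi>\<leftarrow>\<psi>s. pure_assist (M k j *v \<psi>))"
      by (intro sum_mono2 sum_nonneg sum_list_nonneg) (auto simp: pure_assist_nonneg)
    also have "\<dots> = (\<Sum>(k, j)\<in>?I. \<Sum>\<psi>\<leftarrow>\<psi>s. pure_assist (M k j *v \<psi>))"
      by (simp add: sum.Sigma)
    also have "\<dots> = (\<Sum>\<psi>\<leftarrow>\<psi>s. \<Sum>(k, j)\<in>?I. pure_assist (M k j *v \<psi>))"
      by (induction \<psi>s) (simp_all add: sum.distrib case_prod_unfold)
    also have "\<dots> \<le> (\<Sum>\<psi>\<leftarrow>\<psi>s. pure_assist \<psi>)"
      by (intro sum_list_mono pure)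
    finally show ?thesis .
  qed
  then have "(\<Sum>k | k < K \<and> outcome_prob (\<epsilon> k) \<rho> \<noteq> 0.
      outcome_prob (\<epsilon> k) \<rho> * GCoA (outcome_state (\<epsilon> k) \<rho>)) \<le> mixed_assist \<rho>"
    using \<rho> by (intro mixed_assist_greatest) (auto simp: density_op_def)
  then show ?thesis
    by (simp add: GCoA_eq[OF \<rho>])
qed

theorem theorem1:
  assumes "2 \<le> CARD('d::finite)"
  shows "(\<forall>(\<rho> :: ('d \<times> 'd \<times> 's::finite) op) K \<epsilon>.
            density_op \<rho> \<longrightarrow> local_operation K \<epsilon> \<longrightarrow>
            GCoA \<rho> \<ge>
              (\<Sum>k | k < K \<and> outcome_prob (\<epsilon> k) \<rho> \<noteq> 0.
                 outcome_prob (\<epsilon> k) \<rho> * GCoA (outcome_state (\<epsilon> k) \<rho>)))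
       \<and> convex_on {\<rho> :: ('d \<times> 'd \<times> 's) op. density_op \<rho>} GCoA"
  using GCoA_monotone convex_on_GCoA by blast

end
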